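(* Let $n\ge k\ge 1$ be integers. For any permutation $\sigma\in S_k$, the triple statistics $$(\mathrm{MAK}+\mathrm{bInv},\ \mathrm{MAK}'+\mathrm{bInv},\ \mathrm{cinvLSB})\quad\text{and}\quad(\mathrm{MAK}'+\mathrm{bInv},\ \mathrm{MAK}+\mathrm{bInv},\ \mathrm{cinvLSB})$$ are equidistributed on $\mathcal P_n^k(\sigma)$. Moreover, for each choice of $\mathrm{MAG}\in\{\mathrm{MAK},\mathrm{MAK}'\}$, $$\sum_{\pi\in\mathcal P_n^k(\sigma)}p^{(\mathrm{MAG}+\mathrm{bInv})\,\pi}\,q^{\mathrm{cinvLSB}\,\pi}=q^{k(k-1)}\left(\frac pq\right)^{\mathrm{inv}\,\sigma}S_{p,q}(n,k).$$
   Context: $[n]=\{1,\dots,n\}$ and $S_k$ is the symmetric group on $[k]$; $\mathrm{inv}\,\sigma$ is the number of pairs $i<j$ with $\sigma(i)>\sigma(j)$. An ordered partition of $[n]$ into $k$ blocks is a sequence $\pi=B_1/B_2/\cdots/B_k$ of disjoint nonempty subsets (blocks) of $[n]$ whose union is $[n]$. For $\sigma\in S_k$, $\mathcal P_n^k(\sigma)$ is the set of $\sigma$-partitions: ordered partitions of the form $\pi=B_{\sigma(1)}/B_{\sigma(2)}/\cdots/B_{\sigma(k)}$ where $\{B_1,\dots,B_k\}$ is a set partition of $[n]$ with $\min B_1<\min B_2<\cdots<\min B_k$. The opener (resp. closer) of a block is its least (resp. greatest) element; $\mathrm{open}(\pi)$ and $\mathrm{clos}(\pi)$ are the sets of openers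 and closers of the blocks of $\pi$. For $i\in[n]$ let $w_i$ be the index (position, counted from left to right) of the block of $\pi$ containing $i$. Define $\mathrm{ros}(\pi)=\sum_{i=1}^n\#\{j\in\mathrm{open}(\pi): j<i,\ w_j>w_i\}$, $\mathrm{lcs}(\pi)=\sum_{i=1}^n\#\{j\in\mathrm{clos}(\pi): j<i,\ w_j<w_i\}$, $\mathrm{lob}(\pi)=\sum_{i=1}^n\#\{j\in\mathrm{open}(\pi): j>i,\ w_j<w_i\}$, $\mathrm{rcb}(\pi)=\sum_{i=1}^n\#\{j\in\mathrm{clos}(\pi): j>i,\ w_j>w_i\}$, and $\mathrm{lsb}(\pi)=\sum_{i=1}^n\mathrm{lsb}_i(\pi)$, where $\mathrm{lsb}_i(\pi)$ is the number of blocks to the left of the block containing $i$ whose opener is smaller than $i$ and whose closer is greater than $i$. Put $\mathrm{MAK}=\mathrm{ros}+\mathrm{lcs}$ and $\mathrm{MAK}'=\mathrm{lob}+\mathrm{rcb}$. For $\pi=B_1/\cdots/B_k$ write $B_i\succ B_j$ if $\min B_i>\max B_j$; $\mathrm{bInv}(\pi)$ is the number of pairs $i<j$ with $B_i\succ B_j$. Put $\mathrm{cbInv}=\binom k2-\mathrm{bInv}$ and $\mathrm{cinvLSB}=\mathrm{lsb}+\mathrm{cbInv}+\binom k2$. The $p,q$-Stirling numbers are defined by $S_{p,q}(n,k)=p^{k-1}S_{p,q}(n-1,k-1)+[k]_{p,q}S_{p,q}(n-1,k)$ if $0<k\le n$, $S_{p,q}(0,0)=1$, and $S_{p,q}(n,k)=0$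 otherwise, where $[k]_{p,q}=p^{k-1}+p^{k-2}q+\cdots+pq^{k-2}+q^{k-1}$. Two tuples of statistics are equidistributed on a finite set if they have the same joint distribution on it (each tuple of values is attained the same number of times). *)

theory Defs
  imports Complex_Main "HOL-Library.Disjoint_Sets" "HOL-Combinatorics.Permutations"
begin

section \<open>Ordered partitions and \<open>\<sigma>\<close>-partitions\<close>

text \<open>
  An ordered partition is the list of its blocks. In \<open>sigma_partitions\<close>, the monotonicity of
  the minima makes \<open>B\<close> injective on \<open>{1..k}\<close>, so there are exactly \<open>k\<close> distinct blocks.
\<close>

type_synonym ordered_partition = "nat set list"

definition sigma_partitions :: "nat \<Rightarrow> nat \<Rightarrow> (nat \<Rightarrow> nat) \<Rightarrow> ordered_partition set" where
  "sigma_partitions n k \<sigma> =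
     {map (\<lambda>i. B (\<sigma> i)) [1..<Suc k] | B.
        partition_on {1..n} (B ` {1..k}) \<and> strict_mono_on {1..k} (\<lambda>i. Min (B i))}"

definition perm_inv :: "nat \<Rightarrow> (nat \<Rightarrow> nat) \<Rightarrow> nat" where
  "perm_inv k \<sigma> = card {(i, j). i \<in> {1..k} \<and> j \<in> {1..k} \<and> i < j \<and> \<sigma> i > \<sigma> j}"

section \<open>Statistics\<close>

definition openers :: "ordered_partition \<Rightarrow> nat set" where
  "openers \<pi> = Min ` set \<pi>"

definition closers :: "ordered_partition \<Rightarrow> nat set" where
  "closers \<pi> = Max ` set \<pi>"

text \<open>
  Block positions are counted from 0, as list indices; only their relative order is ever used.
  The ground set of \<open>\<pi>\<close> is \<open>\<Union>(set \<pi>)\<close>, which is \<open>{1..n}\<close> for an ordered partition of \<open>{1..n}\<close>.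
\<close>

definition block_index :: "ordered_partition \<Rightarrow> nat \<Rightarrow> nat" where
  "block_index \<pi> i = (THE m. m < length \<pi> \<and> i \<in> \<pi> ! m)"

definition ros :: "ordered_partition \<Rightarrow> nat" where
  "ros \<pi> = (\<Sum>i\<in>\<Union>(set \<pi>). card {j \<in> openers \<pi>. j < i \<and> block_index \<pi> j > block_index \<pi> i})"

definition lcs :: "ordered_partition \<Rightarrow> nat" where
  "lcs \<pi> = (\<Sum>i\<in>\<Union>(set \<pi>). card {j \<in> closers \<pi>. j < i \<and> block_index \<pi> j < block_index \<pi> i})"

definition lob :: "ordered_partition \<Rightarrow> nat" where
  "lob \<pi> = (\<Sum>i\<in>\<Union>(set \<pi>). card {j \<in> openers \<pi>. j > i \<and> block_index \<pi> j < block_index \<pi> i})"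

definition rcb :: "ordered_partition \<Rightarrow> nat" where
  "rcb \<pi> = (\<Sum>i\<in>\<Union>(set \<pi>). card {j \<in> closers \<pi>. j > i \<and> block_index \<pi> j > block_index \<pi> i})"

definition lsb :: "ordered_partition \<Rightarrow> nat" where
  "lsb \<pi> = (\<Sum>i\<in>\<Union>(set \<pi>).
     card {m. m < block_index \<pi> i \<and> Min (\<pi> ! m) < i \<and> Max (\<pi> ! m) > i})"

definition MAK :: "ordered_partition \<Rightarrow> nat" where
  "MAK \<pi> = ros \<pi> + lcs \<pi>"

definition MAK' :: "ordered_partition \<Rightarrow> nat" where
  "MAK' \<pi> = lob \<pi> + rcb \<pi>"

definition bInv :: "ordered_partition \<Rightarrow> nat" where
  "bInv \<pi> = card {(i, j). i < j \<and> j < length \<pi> \<and> Min (\<pi> ! i) > Max (\<pi> ! j)}"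

text \<open>The natural-number subtraction in \<open>cbInv\<close> never truncates, see \<open>bInv_le\<close> below.\<close>

definition cbInv :: "ordered_partition \<Rightarrow> nat" where
  "cbInv \<pi> = (length \<pi> choose 2) - bInv \<pi>"

definition cinvLSB :: "ordered_partition \<Rightarrow> nat" where
  "cinvLSB \<pi> = lsb \<pi> + cbInv \<pi> + (length \<pi> choose 2)"

section \<open>\<open>p,q\<close>-Stirling numbers\<close>

definition pq_bracket :: "'a::comm_semiring_1 \<Rightarrow> 'a \<Rightarrow> nat \<Rightarrow> 'a" where
  "pq_bracket p q k = (\<Sum>i<k. p ^ (k - 1 - i) * q ^ i)"

fun pq_Stirling :: "'a::comm_semiring_1 \<Rightarrow> 'a \<Rightarrow> nat \<Rightarrow> nat \<Rightarrow> 'a" where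
  "pq_Stirling p q 0 0 = 1"
| "pq_Stirling p q 0 (Suc k) = 0"
| "pq_Stirling p q (Suc n) 0 = 0"
| "pq_Stirling p q (Suc n) (Suc k) =
     (if Suc k \<le> Suc n
      then p ^ k * pq_Stirling p q n k + pq_bracket p q (Suc k) * pq_Stirling p q n (Suc k)
      else 0)"

section \<open>Equidistribution\<close>

text \<open>
  Meant for finite \<open>A\<close> (see \<open>finite_sigma_partitions\<close>); for a joint distribution, \<open>f\<close> and \<open>g\<close>
  are tuple-valued.
\<close>

definition equidistributed_on :: "'a set \<Rightarrow> ('a \<Rightarrow> 'b) \<Rightarrow> ('a \<Rightarrow> 'b) \<Rightarrow> bool" where
  "equidistributed_on A f g \<longleftrightarrow> (\<forall>v. card {x \<in> A. f x = v} = card {x \<in> A. g x = v})"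

section \<open>Well-definedness\<close>

lemma bInv_le: "bInv \<pi> \<le> length \<pi> choose 2"
proof -
  let ?k = "length \<pi>"
  let ?S = "{(i, j). i < j \<and> j < ?k}"
  let ?T = "{X. X \<subseteq> {..<?k} \<and> card X = 2}"
  have inj: "inj_on (\<lambda>(i, j). {i, j}) ?S"
    by (auto simp: inj_on_def doubleton_eq_iff)
  have sub: "(\<lambda>(i, j). {i, j}) ` ?S \<subseteq> ?T"
    by auto
  have finT: "finite ?T"
    by (rule finite_subset[of _ "Pow {..<?k}"]) auto
  have finS: "finite ?S"
    by (rule finite_subset[of _ "{..<?k} \<times> {..<?k}"]) auto
  have "bInv \<pi> \<le> card ?S"
    unfolding bInv_def by (rule card_mono[OF finS]) auto
  also have "\<dots> \<le> card ?T"
    by (rule card_inj_on_le[OF inj sub finT])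
  also have "\<dots> = ?k choose 2"
    by (simp add: n_subsets)
  finally show ?thesis .
qed

lemma finite_sigma_partitions:
  assumes "\<sigma> permutes {1..k}"
  shows "finite (sigma_partitions n k \<sigma>)"
proof (rule finite_subset)
  show "sigma_partitions n k \<sigma> \<subseteq> {xs. set xs \<subseteq> Pow {1..n} \<and> length xs = k}"
  proof
    fix \<pi> assume "\<pi> \<in> sigma_partitions n k \<sigma>"
    then obtain B where \<pi>: "\<pi> = map (\<lambda>i. B (\<sigma> i)) [1..<Suc k]"
      and P: "partition_on {1..n} (B ` {1..k})"
      unfolding sigma_partitions_def by blast
    have "B (\<sigma> i) \<subseteq> {1..n}" if "i \<in> {1..k}" for i
      using that P permutes_in_image[OF assms, of i] unfolding partition_on_def by blast
    moreover have "set \<pi> = (\<lambda>i. B (\<sigma> i)) ` {1..k}"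
      unfolding \<pi> by (simp add: atLeastLessThanSuc_atLeastAtMost del: upt_Suc)
    ultimately have "set \<pi> \<subseteq> Pow {1..n}"
      by blast
    then show "\<pi> \<in> {xs. set xs \<subseteq> Pow {1..n} \<and> length xs = k}"
      unfolding \<pi> by (simp del: upt_Suc)
  qed
  show "finite {xs. set xs \<subseteq> Pow {1..n} \<and> length xs = k}"
    by (rule finite_lists_length_eq) simp
qed

end

theory Submission
  imports Defs "HOL-Library.Poly_Mapping" "HOL-Library.Product_Plus"
begin

text \<open>
  Let \<open>B\<^sub>1, \<dots>, B\<^sub>k\<close> be the blocks in the order of their minima, so that a \<open>\<sigma>\<close>-partition has \<open>B\<^sub>l\<close>
  at position \<open>inv \<sigma> l\<close>. Read the ground set from left to right. At the element \<open>i\<close>, with \<open>i \<in> B\<^sub>x\<close>,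
  call a block active if its minimum is less than \<open>i\<close> and its maximum is at least \<open>i\<close>, and let
  \<open>R\<^sub>i\<close> and \<open>L\<^sub>i\<close> be the numbers of active blocks to the right and to the left of \<open>B\<^sub>x\<close>. Three
  elementary counts give

  \<^item> \<open>MAK = (\<Sum>i. R\<^sub>i + #{closers < i})\<close>,
  \<^item> \<open>MAK' = (\<Sum>i. R\<^sub>i + #{openers > i})\<close>,
  \<^item> \<open>lsb = (\<Sum>i. L\<^sub>i)\<close>.

  If \<open>i\<close> is an opener, then \<open>R\<^sub>i\<close> plus the number of closed blocks to the right of \<open>B\<^sub>x\<close> is the number
  of inversions of \<open>\<sigma>\<close> caused by \<open>x\<close>. Summing over the openers (\<open>bInv_perm_inv\<close>), the
  contribution of the openers and of \<open>bInv\<close> to \<open>MAK + bInv\<close>, \<open>MAK' + bInv\<close> and \<open>cinvLSB\<close> becomes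
  independent of \<open>\<sigma>\<close> apart from the constants \<open>I\<close>, \<open>I\<close> and \<open>k (k - 1) - I\<close>, where \<open>I\<close> is the number
  of inversions of \<open>\<sigma>\<close>. What remains is a sum
  of local terms (\<open>MAK_bInv_eq\<close>, \<open>MAK'_bInv_eq\<close>, \<open>cinvLSB_eq\<close>): an opener that finds \<open>h\<close> active
  blocks has weight \<open>q\<^sup>h\<close>, and the \<open>h\<close> choices of a non-opener add up to \<open>[h]\<close> with parameters
  \<open>p t\<close> and \<open>q\<close>; the closers before \<open>i\<close> are marked by \<open>p\<close> and the openers after \<open>i\<close> by \<open>t\<close>.

  So the trivariate generating function counts weighted walks of length \<open>n\<close> from \<open>(0, 0)\<close> to
  \<open>(0, k)\<close> on the states \<open>(h, c)\<close> with \<open>h\<close> active and \<open>c\<close> closed blocks (\<open>active_sum_eq_walk\<close>). For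
  a walk that starts and ends at height \<open>0\<close>, only the products of the weights of an up-step and of
  the down-step between the same heights matter; hence reversing the walk exchanges \<open>p\<close> and \<open>t\<close>
  (\<open>walk_symmetric\<close>). This is the equidistribution, once \<open>p\<close>, \<open>t\<close>, \<open>q\<close> are taken to be monomials
  of a monoid semiring, where the sum determines the joint distribution.

  For \<open>t = 1\<close>, collect the walks from \<open>(0, 0)\<close> to \<open>(h, c)\<close> as a polynomial in \<open>y\<^sup>h x\<^sup>c\<close>. One step maps \<open>f\<close>
  to \<open>(x + y) (f(p x, q y) + D f(p x, y))\<close>, where \<open>D\<close> acts on the powers of \<open>y\<close> by
  \<open>D y\<^sup>h = [h] y\<^sup>h\<^sup>-\<^sup>1\<close>. The products
  \<open>f\<^sub>k = (x + y) (p x + q y) \<dots> (p\<^sup>k\<^sup>-\<^sup>1 x + q\<^sup>k\<^sup>-\<^sup>1 y)\<close> are sent to \<open>f\<^sub>k\<^sub>+\<^sub>1 + [k] f\<^sub>k\<close>, which is the recurrence of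
  the Stirling numbers without the powers of \<open>p\<close>; these come back as the coefficient
  \<open>p ^ (k choose 2)\<close> of \<open>x\<^sup>k\<close> in \<open>f\<^sub>k\<close> (\<open>walk_closed_form\<close>, \<open>pq_Stirling_eq\<close>).
\<close>

section \<open>Weighted walks\<close>

text \<open>
  \<open>walk V M n u v\<close> is the total weight of the walks of length \<open>n\<close> from \<open>u\<close> to \<open>v\<close> whose later vertices
  lie in \<open>V\<close>; a step from \<open>w\<close> to \<open>x\<close> has weight \<open>M w x\<close>.
\<close>
fun walk :: "'s set \<Rightarrow> ('s \<Rightarrow> 's \<Rightarrow> 'a::comm_semiring_1) \<Rightarrow> nat \<Rightarrow> 's \<Rightarrow> 's \<Rightarrow> 'a" where
  "walk V M 0 u v = (if u = v then 1 else 0)"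
| "walk V M (Suc n) u v = (\<Sum>w\<in>V. M u w * walk V M n w v)"

lemma walk_Suc_right:
  assumes "finite V" "u \<in> V" "v \<in> V"
  shows "walk V M (Suc n) u v = (\<Sum>w\<in>V. walk V M n u w * M w v)"
  using assms(2)
proof (induction n arbitrary: u)
  case 0
  have "(\<Sum>w\<in>V. M u w * (if w = v then 1 else 0)) = (\<Sum>w\<in>V. if w = v then M u w else 0)"
    by (rule sum.cong) auto
  moreover have "(\<Sum>w\<in>V. (if u = w then 1 else 0) * M w v) = (\<Sum>w\<in>V. if u = w then M w v else 0)"
    by (rule sum.cong) auto
  ultimately show ?case
    using assms 0 by (simp add: sum.delta sum.delta')
next
  case (Suc n)
  have "walk V M (Suc (Suc n)) u v = (\<Sum>w\<in>V. M u w * (\<Sum>x\<in>V. walk V M n w x * M x v))"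
    unfolding walk.simps(2)[of V M "Suc n"] using Suc.IH by (intro sum.cong) auto
  also have "\<dots> = (\<Sum>x\<in>V. \<Sum>w\<in>V. M u w * walk V M n w x * M x v)"
    unfolding sum_distrib_left mult.assoc[symmetric] by (rule sum.swap)
  also have "\<dots> = (\<Sum>x\<in>V. walk V M (Suc n) u x * M x v)"
    by (simp add: sum_distrib_right)
  finally show ?case .
qed

text \<open>
  Conjugating the step weights by a function of the vertices changes the walk weights only by the
  end points. Stated without division, so that the gauge function may have zeros.
\<close>
lemma walk_gauge:
  assumes "\<And>u v. u \<in> V \<Longrightarrow> v \<in> V \<Longrightarrow> \<phi> u * M u v = M' u v * \<phi> v" and "u \<in> V"
  shows "\<phi> u * walk V M n u v = walk V M' n u v * \<phi> v"
  using assms(2)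
proof (induction n arbitrary: u)
  case (Suc n)
  have "\<phi> u * walk V M (Suc n) u v = (\<Sum>w\<in>V. (\<phi> u * M u w) * walk V M n w v)"
    by (simp add: sum_distrib_left mult.assoc)
  also have "\<dots> = (\<Sum>w\<in>V. M' u w * (\<phi> w * walk V M n w v))"
    by (rule sum.cong) (simp_all add: assms(1) Suc.prems mult.assoc)
  also have "\<dots> = walk V M' (Suc n) u v * \<phi> v"
    by (simp add: Suc.IH sum_distrib_right mult.assoc)
  finally show ?case .
qed auto

lemma walk_reverse:
  assumes "finite V" and bij: "bij_betw \<rho> V V"
    and rev: "\<And>u v. u \<in> V \<Longrightarrow> v \<in> V \<Longrightarrow> M u v = M' (\<rho> v) (\<rho> u)"
    and "u \<in> V" "v \<in> V"
  shows "walk V M n u v = walk V M' n (\<rho> v) (\<rho> u)"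
  using assms(4)
proof (induction n arbitrary: u)
  case 0
  then show ?case
    using bij assms(5) by (auto simp: bij_betw_def inj_on_def)
next
  case (Suc n)
  have "walk V M (Suc n) u v = (\<Sum>w\<in>V. walk V M' n (\<rho> v) (\<rho> w) * M' (\<rho> w) (\<rho> u))"
    using Suc rev by (auto intro!: sum.cong simp: mult.commute)
  also have "\<dots> = (\<Sum>w\<in>V. walk V M' n (\<rho> v) w * M' w (\<rho> u))"
    using sum.reindex_bij_betw[OF bij, of "\<lambda>w. walk V M' n (\<rho> v) w * M' w (\<rho> u)"] by simp
  also have "\<dots> = walk V M' (Suc n) (\<rho> v) (\<rho> u)"
    using Suc.prems assms(1,5) bij by (intro walk_Suc_right[symmetric]) (auto dest: bij_betwE)
  finally show ?case .
qed

text \<open>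
  A state \<open>(h, c)\<close> stands for \<open>h\<close> active and \<open>c\<close> closed blocks, out of \<open>k\<close> blocks in total.
\<close>
definition levels :: "nat \<Rightarrow> (nat \<times> nat) set" where
  "levels k = {(h, c). h + c \<le> k}"

lemma mem_levels [simp]: "(h, c) \<in> levels k \<longleftrightarrow> h + c \<le> k"
  by (simp add: levels_def)

lemma finite_levels: "finite (levels k)"
  by (rule finite_subset[of _ "{..k} \<times> {..k}"]) (auto simp: levels_def)

text \<open>
  The four kinds of steps, at height \<open>h\<close>: a singleton block (weight \<open>s h\<close>), the opener of a larger
  block (up-step, weight \<open>a h\<close>), an element that is neither minimum nor maximum of its block (weight
  \<open>l h\<close>), and the closer of a larger block (down-step from \<open>Suc h'\<close> to \<open>h'\<close>, weight \<open>b h'\<close>). In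
  addition \<open>p\<close> marks the blocks closed before the step, and \<open>t\<close> those not yet opened after it.
\<close>
definition step_weight :: "nat \<Rightarrow> 'a::comm_semiring_1 \<Rightarrow> 'a \<Rightarrow> (nat \<Rightarrow> 'a) \<Rightarrow> (nat \<Rightarrow> 'a) \<Rightarrow>
    (nat \<Rightarrow> 'a) \<Rightarrow> (nat \<Rightarrow> 'a) \<Rightarrow> nat \<times> nat \<Rightarrow> nat \<times> nat \<Rightarrow> 'a" where
  "step_weight k p t s l a b = (\<lambda>(h, c) (h', c'). p ^ c * t ^ (k - (h' + c')) *
     ((if h' = h \<and> c' = Suc c then s h else 0) + (if h' = Suc h \<and> c' = c then a h else 0) +
      (if h' = h \<and> c' = c then l h else 0) + (if h = Suc h' \<and> c' = Suc c then b h' else 0)))"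

text \<open>
  All the weight of an up-step can be shifted to the matching down-step.
\<close>
lemma walk_swap_up_down:
  "walk (levels k) (step_weight k p t s l a b) n (0, 0) (0, k) =
   walk (levels k) (step_weight k p t s l (\<lambda>_. 1) (\<lambda>h. a h * b h)) n (0, 0) (0, k)"
proof -
  let ?\<phi> = "\<lambda>(h, c::nat). \<Prod>j<h. a j"
  have "?\<phi> u * step_weight k p t s l a b u v =
        step_weight k p t s l (\<lambda>_. 1) (\<lambda>h. a h * b h) u v * ?\<phi> v" for u v
    by (cases u; cases v) (auto simp: step_weight_def algebra_simps)
  from walk_gauge[of "levels k" ?\<phi>, OF this, of "(0, 0)" n "(0, k)"] show ?thesis
    by (simp add: levels_def)
qed

text \<open>
  Read backwards, closed blocks become unopened ones, so the state \<open>(h, c)\<close> becomes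
  \<open>(h, k - (h + c))\<close>; up-steps and down-steps are exchanged, and so are \<open>p\<close> and \<open>t\<close>.
\<close>
lemma walk_reverse_levels:
  "walk (levels k) (step_weight k p t s l a b) n (0, 0) (0, k) =
   walk (levels k) (step_weight k t p s l b a) n (0, 0) (0, k)"
proof -
  let ?\<rho> = "\<lambda>(h, c). (h, k - (h + c))"
  have bij: "bij_betw ?\<rho> (levels k) (levels k)"
    by (rule bij_betw_byWitness[where f' = ?\<rho>]) (auto simp: levels_def)
  have "step_weight k p t s l a b u v = step_weight k t p s l b a (?\<rho> v) (?\<rho> u)"
    if "u \<in> levels k" "v \<in> levels k" for u v
  proof -
    obtain h c h' c' where uv: "u = (h, c)" "v = (h', c')"
      by (cases u; cases v)
    have "k - (h + (k - (h + c))) = c"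
      and "h = h' \<and> k - (h + c) = Suc (k - (h' + c')) \<longleftrightarrow> h' = h \<and> c' = Suc c"
      and "h = Suc h' \<and> k - (h + c) = k - (h' + c') \<longleftrightarrow> h = Suc h' \<and> c' = Suc c"
      and "h = h' \<and> k - (h + c) = k - (h' + c') \<longleftrightarrow> h' = h \<and> c' = c"
      and "h' = Suc h \<and> k - (h + c) = Suc (k - (h' + c')) \<longleftrightarrow> h' = Suc h \<and> c' = c"
      using that by (auto simp: uv levels_def)
    then show ?thesis
      unfolding uv step_weight_def prod.case by (simp only: ac_simps) (auto simp: ac_simps)
  qed
  from walk_reverse[where M = "step_weight k p t s l a b" and M' = "step_weight k t p s l b a"
      and \<rho> = ?\<rho> and u = "(0, 0)" and v = "(0, k)", OF finite_levels bij this]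
  show ?thesis
    by simp
qed

lemma walk_symmetric:
  "walk (levels k) (step_weight k p t s l a b) n (0, 0) (0, k) =
   walk (levels k) (step_weight k t p s l a b) n (0, 0) (0, k)"
proof -
  have "walk (levels k) (step_weight k p t s l a b) n (0, 0) (0, k) =
        walk (levels k) (step_weight k t p s l (\<lambda>h. a h * b h) (\<lambda>_. 1)) n (0, 0) (0, k)"
    by (simp only: walk_swap_up_down[of _ _ _ _ _ a b] walk_reverse_levels[of _ p t])
  also have "\<dots> = walk (levels k) (step_weight k t p s l a b) n (0, 0) (0, k)"
    by (simp only: walk_swap_up_down[of _ _ _ _ _ a b]
        walk_swap_up_down[of _ _ _ _ _ "\<lambda>h. a h * b h" "\<lambda>_. 1"] mult_1_right)
  finally show ?thesis .
qed

lemma step_weight_sum_left: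
  assumes "h + c \<le> k"
  shows "(\<Sum>u\<in>levels k. step_weight k p t s l a b (h, c) u * g u) =
    (if h + c < k then p ^ c * t ^ (k - Suc (h + c)) * (s h * g (h, Suc c) + a h * g (Suc h, c)) else 0) +
    p ^ c * t ^ (k - (h + c)) *
      (l h * g (h, c) + (case h of 0 \<Rightarrow> 0 | Suc h' \<Rightarrow> b h' * g (h', Suc c)))"
proof -
  let ?t = "\<lambda>u. t ^ (k - (fst u + snd u))"
  let ?S = "\<lambda>u. if u = (h, Suc c) then s h * ?t u * g u else 0"
  let ?A = "\<lambda>u. if u = (Suc h, c) then a h * ?t u * g u else 0"
  let ?L = "\<lambda>u. if u = (h, c) then l h * ?t u * g u else 0"
  let ?B = "\<lambda>u. case h of 0 \<Rightarrow> 0 | Suc j \<Rightarrow> if u = (j, Suc c) then b j * ?t u * g u else 0"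
  have "step_weight k p t s l a b (h, c) u * g u = p ^ c * (?S u + ?A u + ?L u + ?B u)" for u
  proof -
    obtain h' c' where u: "u = (h', c')"
      by (cases u)
    have "step_weight k p t s l a b (h, c) u * g u = p ^ c *
      ((if h' = h \<and> c' = Suc c then s h else 0) * ?t u * g u +
       (if h' = Suc h \<and> c' = c then a h else 0) * ?t u * g u +
       (if h' = h \<and> c' = c then l h else 0) * ?t u * g u +
       (if h = Suc h' \<and> c' = Suc c then b h' else 0) * ?t u * g u)"
      unfolding step_weight_def u prod.case fst_conv snd_conv
      by (simp only: distrib_left distrib_right ac_simps)
    also have "(if h' = h \<and> c' = Suc c then s h else 0) * ?t u * g u = ?S u"
      by (simp add: u)
    also have "(if h' = Suc h \<and> c' = c then a h else 0) * ?t u * g u = ?A u"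
      by (simp add: u)
    also have "(if h' = h \<and> c' = c then l h else 0) * ?t u * g u = ?L u"
      by (simp add: u)
    also have "(if h = Suc h' \<and> c' = Suc c then b h' else 0) * ?t u * g u = ?B u"
      by (cases h) (auto simp add: u)
    finally show ?thesis .
  qed
  moreover have "sum ?S (levels k) = (if h + c < k then s h * t ^ (k - Suc (h + c)) * g (h, Suc c) else 0)"
    using assms by (simp add: sum.delta finite_levels Suc_le_eq)
  moreover have "sum ?A (levels k) = (if h + c < k then a h * t ^ (k - Suc (h + c)) * g (Suc h, c) else 0)"
    using assms by (simp add: sum.delta finite_levels Suc_le_eq)
  moreover have "sum ?L (levels k) = l h * t ^ (k - (h + c)) * g (h, c)"
    using assms by (simp add: sum.delta finite_levels)
  moreover have "sum ?B (levels k) =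
      (case h of 0 \<Rightarrow> 0 | Suc j \<Rightarrow> b j * t ^ (k - (h + c)) * g (j, Suc c))"
    using assms by (cases h) (simp_all add: sum.delta finite_levels)
  ultimately show ?thesis
    by (simp add: sum_distrib_left[symmetric] sum.distrib distrib_left ac_simps split: nat.split)
qed

lemma step_weight_sum_right:
  assumes "h + c \<le> k"
  shows "(\<Sum>u\<in>levels k. g u * step_weight k p 1 s l a b u (h, c)) =
    (case c of 0 \<Rightarrow> 0 | Suc c' \<Rightarrow> p ^ c' * (s h * g (h, c') + b h * g (Suc h, c'))) +
    p ^ c * (l h * g (h, c) + (case h of 0 \<Rightarrow> 0 | Suc h' \<Rightarrow> a h' * g (h', c)))"
proof -
  let ?S = "\<lambda>u. case c of 0 \<Rightarrow> 0 | Suc d \<Rightarrow> if u = (h, d) then p ^ d * s h * g u else 0"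
  let ?B = "\<lambda>u. case c of 0 \<Rightarrow> 0 | Suc d \<Rightarrow> if u = (Suc h, d) then p ^ d * b h * g u else 0"
  let ?L = "\<lambda>u. if u = (h, c) then p ^ c * l h * g u else 0"
  let ?A = "\<lambda>u. case h of 0 \<Rightarrow> 0 | Suc j \<Rightarrow> if u = (j, c) then p ^ c * a j * g u else 0"
  have "g u * step_weight k p 1 s l a b u (h, c) = ?S u + ?A u + ?L u + ?B u" for u
  proof -
    obtain h' c' where u: "u = (h', c')"
      by (cases u)
    have "g u * step_weight k p 1 s l a b u (h, c) =
       p ^ c' * (if h = h' \<and> c = Suc c' then s h' else 0) * g u +
       p ^ c' * (if h = Suc h' \<and> c = c' then a h' else 0) * g u +
       p ^ c' * (if h = h' \<and> c = c' then l h' else 0) * g u +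
       p ^ c' * (if h' = Suc h \<and> c = Suc c' then b h else 0) * g u"
      unfolding step_weight_def u prod.case power_one mult_1_right
      by (simp only: distrib_left distrib_right ac_simps)
    also have "p ^ c' * (if h = h' \<and> c = Suc c' then s h' else 0) * g u = ?S u"
      by (cases c) (auto simp: u)
    also have "p ^ c' * (if h = Suc h' \<and> c = c' then a h' else 0) * g u = ?A u"
      by (cases h) (auto simp: u)
    also have "p ^ c' * (if h = h' \<and> c = c' then l h' else 0) * g u = ?L u"
      by (auto simp: u)
    also have "p ^ c' * (if h' = Suc h \<and> c = Suc c' then b h else 0) * g u = ?B u"
      by (cases c) (auto simp: u)
    finally show ?thesis .
  qed
  moreover have "sum ?S (levels k) = (case c of 0 \<Rightarrow> 0 | Suc d \<Rightarrow> p ^ d * s h * g (h, d))"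
    using assms by (cases c) (simp_all add: sum.delta finite_levels)
  moreover have "sum ?B (levels k) = (case c of 0 \<Rightarrow> 0 | Suc d \<Rightarrow> p ^ d * b h * g (Suc h, d))"
    using assms by (cases c) (simp_all add: sum.delta finite_levels)
  moreover have "sum ?L (levels k) = p ^ c * l h * g (h, c)"
    using assms by (simp add: sum.delta finite_levels)
  moreover have "sum ?A (levels k) = (case h of 0 \<Rightarrow> 0 | Suc j \<Rightarrow> p ^ c * a j * g (j, c))"
    using assms by (cases h) (simp_all add: sum.delta finite_levels)
  ultimately show ?thesis
    by (simp add: sum.distrib distrib_left ac_simps split: nat.split)
qed

section \<open>Stirling numbers and the generating function for \<open>t = 1\<close>\<close>

lemma pq_bracket_0: "pq_bracket p q 0 = 0"
  by (simp add: pq_bracket_def)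

lemma pq_bracket_Suc: "pq_bracket p q (Suc k) = p * pq_bracket p q k + q ^ k"
proof -
  have "(\<Sum>i<k. p ^ (k - i) * q ^ i) = (\<Sum>i<k. p * (p ^ (k - 1 - i) * q ^ i))"
  proof (rule sum.cong)
    fix i assume "i \<in> {..<k}"
    then have "k - i = Suc (k - 1 - i)" by auto
    then show "p ^ (k - i) * q ^ i = p * (p ^ (k - 1 - i) * q ^ i)"
      by (simp add: mult.assoc)
  qed simp
  then show ?thesis
    by (simp add: pq_bracket_def sum_distrib_left)
qed

lemma pq_bracket_add: "pq_bracket p q (c + h) = p ^ c * pq_bracket p q h + q ^ h * pq_bracket p q c"
  by (induction c) (simp_all add: pq_bracket_0 pq_bracket_Suc algebra_simps power_add)

context
  fixes p q :: "'a::comm_semiring_1"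
begin

text \<open>
  The Stirling numbers with the factor \<open>p ^ (k choose 2)\<close> removed.
\<close>
fun reduced_Stirling :: "nat \<Rightarrow> nat \<Rightarrow> 'a" where
  "reduced_Stirling 0 0 = 1"
| "reduced_Stirling 0 (Suc k) = 0"
| "reduced_Stirling (Suc n) 0 = 0"
| "reduced_Stirling (Suc n) (Suc k) =
     reduced_Stirling n k + pq_bracket p q (Suc k) * reduced_Stirling n (Suc k)"

lemma reduced_Stirling_eq_0: "n < k \<Longrightarrow> reduced_Stirling n k = 0"
  by (induction n k rule: reduced_Stirling.induct) auto

lemma pq_Stirling_eq: "pq_Stirling p q n k = p ^ (k choose 2) * reduced_Stirling n k"
proof (induction n k rule: reduced_Stirling.induct)
  case (4 n k)
  have "Suc k choose 2 = k + (k choose 2)"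
    by (simp add: numeral_2_eq_2)
  then show ?case
    using 4 by (auto simp: reduced_Stirling_eq_0 power_add algebra_simps)
qed (auto simp: numeral_2_eq_2)

text \<open>
  \<open>bin_weight c h\<close> is the coefficient of \<open>x\<^sup>c y\<^sup>h\<close> in the product of the \<open>p\<^sup>j x + q\<^sup>j y\<close> over
  \<open>j < c + h\<close>. The recursion is \<open>f\<^sub>k\<^sub>+\<^sub>1(x, y) = (x + y) f\<^sub>k(p x, q y)\<close> for these products.
\<close>
fun bin_weight :: "nat \<Rightarrow> nat \<Rightarrow> 'a" where
  "bin_weight 0 0 = 1"
| "bin_weight (Suc c) 0 = p ^ c * bin_weight c 0"
| "bin_weight 0 (Suc h) = q ^ h * bin_weight 0 h"
| "bin_weight (Suc c) (Suc h) =
     p ^ c * q ^ Suc h * bin_weight c (Suc h) + p ^ Suc c * q ^ h * bin_weight (Suc c) h"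

text \<open>
  With \<open>D y\<^sup>h = [h] y\<^sup>h\<^sup>-\<^sup>1\<close>, this says that \<open>[k] f\<^sub>k(x, y) = (x + y) D f\<^sub>k(p x, y)\<close>, once
  \<open>[c + h] = p\<^sup>c [h] + q\<^sup>h [c]\<close> is used to split the left-hand side. It is proved by reducing both
  sides to the same multiple of \<open>bin_weight c h\<close>.
\<close>
lemma bin_weight_shift:
  "q ^ h * pq_bracket p q (Suc c) * bin_weight (Suc c) h =
   p ^ c * pq_bracket p q (Suc h) * bin_weight c (Suc h)"
proof -
  show ?thesis
  proof (induction "c + h" arbitrary: c h rule: less_induct)
    case less
    let ?B = "pq_bracket p q" and ?b = "bin_weight"
    have L: "q ^ h * ?B (Suc c) * ?b (Suc c) h = p ^ c * q ^ h * ?b c h * ?B (Suc (c + h))"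
    proof (cases h)
      case 0
      then show ?thesis by (simp add: algebra_simps)
    next
      case (Suc j)
      have IH: "q ^ j * ?B (Suc c) * ?b (Suc c) j = p ^ c * ?B (Suc j) * ?b c (Suc j)"
        using less[of c j] Suc by simp
      have "q ^ h * ?B (Suc c) * ?b (Suc c) h =
          p ^ c * q ^ h * ?b c h * (q ^ h * ?B (Suc c)) + q ^ h * p ^ Suc c * (q ^ j * ?B (Suc c) * ?b (Suc c) j)"
        by (simp add: Suc algebra_simps)
      also have "\<dots> = p ^ c * q ^ h * ?b c h * (p ^ Suc c * ?B h + q ^ h * ?B (Suc c))"
        unfolding IH by (simp add: Suc algebra_simps)
      also have "p ^ Suc c * ?B h + q ^ h * ?B (Suc c) = ?B (Suc (c + h))"
        using pq_bracket_add[of p q "Suc c" h] by simp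
      finally show ?thesis .
    qed
    have R: "p ^ c * ?B (Suc h) * ?b c (Suc h) = p ^ c * q ^ h * ?b c h * ?B (Suc (c + h))"
    proof (cases c)
      case 0
      then show ?thesis by (simp add: algebra_simps)
    next
      case (Suc d)
      have IH: "q ^ h * ?B (Suc d) * ?b (Suc d) h = p ^ d * ?B (Suc h) * ?b d (Suc h)"
        using less[of d h] Suc by simp
      have "p ^ c * ?B (Suc h) * ?b c (Suc h) =
          p ^ c * q ^ Suc h * (p ^ d * ?B (Suc h) * ?b d (Suc h)) + p ^ c * q ^ h * ?b c h * (p ^ c * ?B (Suc h))"
        by (simp add: Suc algebra_simps)
      also have "\<dots> = p ^ c * q ^ h * ?b c h * (p ^ c * ?B (Suc h) + q ^ Suc h * ?B c)"
        unfolding IH[symmetric] by (simp add: Suc algebra_simps)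
      also have "p ^ c * ?B (Suc h) + q ^ Suc h * ?B c = ?B (Suc (c + h))"
        using pq_bracket_add[of p q c "Suc h"] by simp
      finally show ?thesis .
    qed
    show ?case
      by (simp only: L R)
  qed
qed

lemma bin_weight_0: "bin_weight c 0 = p ^ (c choose 2)"
  by (induction c) (simp_all add: numeral_2_eq_2 power_add)

lemma walk_closed_form:
  assumes "h + c \<le> k"
  shows "walk (levels k) (step_weight k p 1 (power q) (pq_bracket p q) (power q)
           (\<lambda>h. pq_bracket p q (Suc h))) n (0, 0) (h, c) =
         reduced_Stirling n (h + c) * bin_weight c h"
  using assms
proof (induction n arbitrary: h c)
  case 0
  then show ?case by (cases h; cases c) auto
next
  case (Suc n)
  let ?M = "step_weight k p 1 (power q) (pq_bracket p q) (power q) (\<lambda>h. pq_bracket p q (Suc h))"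
  let ?B = "pq_bracket p q" and ?b = "bin_weight" and ?r = "reduced_Stirling n"
  have "walk (levels k) ?M (Suc n) (0, 0) (h, c) =
        (\<Sum>u\<in>levels k. walk (levels k) ?M n (0, 0) u * ?M u (h, c))"
    using Suc.prems by (intro walk_Suc_right finite_levels) (auto simp: levels_def)
  also have "\<dots> = (case c of 0 \<Rightarrow> 0 | Suc d \<Rightarrow> p ^ d *
        (q ^ h * (?r (h + d) * ?b d h) + ?B (Suc h) * (?r (Suc h + d) * ?b d (Suc h)))) +
      p ^ c * (?B h * (?r (h + c) * ?b c h) +
        (case h of 0 \<Rightarrow> 0 | Suc j \<Rightarrow> q ^ j * (?r (j + c) * ?b c j)))"
    unfolding step_weight_sum_right[OF Suc.prems]
    using Suc.prems by (auto simp: Suc.IH split: nat.split)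
  also have "\<dots> = reduced_Stirling (Suc n) (h + c) * ?b c h"
  proof (cases c)
    case 0
    then show ?thesis
      by (cases h) (simp_all add: pq_bracket_0 algebra_simps)
  next
    case c: (Suc d)
    \<comment> \<open>The two summands of the Stirling recurrence: \<open>new\<close> rewrites the one with first factor \<open>1\<close>,
      \<open>split\<close> the one with first factor \<open>[h + c]\<close>.\<close>
    have split: "?B (h + c) * ?b c h = p ^ d * ?B (Suc h) * ?b d (Suc h) + p ^ c * ?B h * ?b c h"
      using bin_weight_shift[of h d] pq_bracket_add[of p q c h] by (simp add: c algebra_simps)
    have new: "?b c h = p ^ d * q ^ h * ?b d h + (case h of 0 \<Rightarrow> 0 | Suc j \<Rightarrow> p ^ c * q ^ j * ?b c j)"
      by (cases h) (simp_all add: c algebra_simps)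
    have "reduced_Stirling (Suc n) (h + c) * ?b c h =
        ?r (h + d) * ?b c h + ?r (h + c) * (?B (h + c) * ?b c h)"
      by (simp add: c algebra_simps)
    also have "\<dots> = ?r (h + d) * (p ^ d * q ^ h * ?b d h + (case h of 0 \<Rightarrow> 0 | Suc j \<Rightarrow> p ^ c * q ^ j * ?b c j))
        + ?r (h + c) * (p ^ d * ?B (Suc h) * ?b d (Suc h) + p ^ c * ?B h * ?b c h)"
      by (simp only: split new[symmetric])
    finally show ?thesis
      by (cases h) (simp_all add: c algebra_simps)
  qed
  finally show ?case .
qed

end

section \<open>Restricted growth words\<close>

text \<open>
  The choice of one of the active blocks, weighted by the numbers of active blocks on either side.
\<close>
lemma sum_rank_weight:
  fixes pos :: "nat \<Rightarrow> nat" and P q :: "'a::comm_semiring_1"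
  assumes "finite A" "inj_on pos A"
  shows "(\<Sum>x\<in>A. P ^ card {y\<in>A. pos x < pos y} * q ^ card {y\<in>A. pos y < pos x}) =
         pq_bracket P q (card A)"
  using assms
proof (induction "card A" arbitrary: A)
  case 0
  then show ?case by (simp add: pq_bracket_0)
next
  case (Suc m)
  then have "A \<noteq> {}" by auto
  then have "Max (pos ` A) \<in> pos ` A"
    using Suc.prems by (intro Max_in) auto
  then obtain z where z: "z \<in> A" "pos z = Max (pos ` A)"
    by (metis imageE)
  have less: "pos y < pos z" if "y \<in> A - {z}" for y
  proof -
    have "pos y \<le> pos z"
      using that Suc.prems(1) z(2) by simp
    moreover have "pos y \<noteq> pos z"
      using that z(1) Suc.prems(2) by (auto dest: inj_onD)
    ultimately show ?thesis by simp
  qed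
  have m: "m = card (A - {z})"
    using Suc z by simp
  have top: "{y\<in>A. pos z < pos y} = {}" "{y\<in>A. pos y < pos z} = A - {z}"
    using less by fastforce+
  have "P ^ card {y\<in>A. pos x < pos y} * q ^ card {y\<in>A. pos y < pos x} =
      P * (P ^ card {y\<in>A - {z}. pos x < pos y} * q ^ card {y\<in>A - {z}. pos y < pos x})"
    if "x \<in> A - {z}" for x
  proof -
    have "{y\<in>A. pos x < pos y} = insert z {y\<in>A - {z}. pos x < pos y}"
      and "{y\<in>A. pos y < pos x} = {y\<in>A - {z}. pos y < pos x}"
      using less[OF that] z that by auto
    then show ?thesis
      using Suc.prems(1) by (simp add: mult.assoc)
  qed
  then have "(\<Sum>x\<in>A - {z}. P ^ card {y\<in>A. pos x < pos y} * q ^ card {y\<in>A. pos y < pos x}) =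
      P * pq_bracket P q m"
    using Suc.hyps(1)[OF m] Suc.prems m by (simp add: sum_distrib_left[symmetric] inj_on_diff)
  moreover have "card A = Suc m" using Suc by simp
  moreover have "card (A - {z}) = m"
    using m by simp
  ultimately show ?case
    unfolding sum.remove[OF Suc.prems(1) z(1)] top by (simp add: pq_bracket_Suc add.commute)
qed

text \<open>
  The word of a partition lists, for each element of the ground set, the label of its block, where the
  blocks are labelled \<open>1, \<dots>, k\<close> by increasing minima; such words are the restricted growth words.
  \<open>growth_words k m n\<close> contains the suffixes of length \<open>n\<close> of such words after \<open>m\<close> labels have
  occurred: a letter is one of the labels seen before or the least new one.
\<close>
definition growth_words :: "nat \<Rightarrow> nat \<Rightarrow> nat \<Rightarrow> nat list set" where
  "growth_words k m n = {xs. length xs = n \<and> {1..m} \<union> set xs = {1..k} \<and>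
     (\<forall>i<n. {1..<xs ! i} \<subseteq> {1..m} \<union> set (take i xs))}"

lemma finite_growth_words: "finite (growth_words k m n)"
  by (rule finite_subset[OF _ finite_lists_length_eq[of "{1..k}" n]]) (auto simp: growth_words_def)

lemma growth_words_empty:
  assumes "k < m"
  shows "growth_words k m n = {}"
proof -
  have "m \<in> {1..m}" "m \<notin> {1..k}" using assms by auto
  then show ?thesis unfolding growth_words_def by blast
qed

lemma growth_words_0: "growth_words k m 0 = (if m = k then {[]} else {})"
  by (auto simp: growth_words_def)

lemma Cons_in_growth_words:
  "x # xs \<in> growth_words k m (Suc n) \<longleftrightarrow>
     x = Suc m \<and> xs \<in> growth_words k (Suc m) n \<or> x \<in> {1..m} \<and> xs \<in> growth_words k m n"
proof -
  have *: "x # xs \<in> growth_words k m (Suc n) \<longleftrightarrow> {1..<x} \<subseteq> {1..m} \<and> length xs = n \<and>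
      insert x {1..m} \<union> set xs = {1..k} \<and>
      (\<forall>i<n. {1..<xs ! i} \<subseteq> insert x {1..m} \<union> set (take i xs))"
    unfolding growth_words_def by (auto simp: All_less_Suc2)
  consider "x = Suc m" | "x \<in> {1..m}" | "x = 0" | "x > Suc m"
    by fastforce
  then show ?thesis
  proof cases
    case 1
    then show ?thesis
      unfolding * by (auto simp: growth_words_def atLeastAtMostSuc_conv)
  next
    case 2
    then have "insert x {1..m} = {1..m}" "{1..<x} \<subseteq> {1..m}" by auto
    then show ?thesis
      using 2 unfolding * by (auto simp: growth_words_def)
  next
    case 3
    have "0 \<notin> {1..k}" by simp
    then have "insert x {1..m} \<union> set xs \<noteq> {1..k}" using 3 by blast
    then show ?thesis
      unfolding * using 3 by simp
  next
    case 4
    then have "\<not> {1..<x} \<subseteq> {1..m}" by (auto simp: subset_iff intro: exI[of _ "Suc m"])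
    then show ?thesis
      unfolding * using 4 by simp
  qed
qed

text \<open>
  Sum of local terms along a word: at a letter \<open>x\<close>, the function \<open>e\<close> receives the set of the letters
  before \<open>x\<close> (with \<open>P\<close> as the initial set) and the set of the letters from \<open>x\<close> on.
\<close>
fun scan :: "(nat set \<Rightarrow> nat \<Rightarrow> nat set \<Rightarrow> nat) \<Rightarrow> nat set \<Rightarrow> nat list \<Rightarrow> nat" where
  "scan e P [] = 0"
| "scan e P (x # xs) = e P x (set (x # xs)) + scan e (insert x P) xs"

lemma scan_eq_sum:
  "scan e P xs = (\<Sum>i<length xs. e (P \<union> set (take i xs)) (xs ! i) (set (drop i xs)))"
proof (induction xs arbitrary: P)
  case (Cons x xs)
  then show ?case
    by (simp add: sum.lessThan_Suc_shift del: sum.lessThan_Suc)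
qed simp

text \<open>
  The local terms of \<open>MAK + bInv\<close>, \<open>MAK' + bInv\<close> and \<open>cinvLSB\<close>. Here \<open>P\<close> contains the blocks opened
  before the current element, \<open>S\<close> the blocks that close at this element or later, \<open>x\<close> is the block of
  the element, and \<open>pos\<close> gives the positions of the blocks. Thus \<open>P \<inter> S\<close> is the set of active blocks, \<open>P - S\<close>
  that of closed blocks, and \<open>x \<notin> P\<close> means that the element is an opener.
\<close>
definition mak_term :: "(nat \<Rightarrow> nat) \<Rightarrow> nat set \<Rightarrow> nat \<Rightarrow> nat set \<Rightarrow> nat" where
  "mak_term pos P x S = (if x \<in> P then card {y \<in> P \<inter> S. pos x < pos y} else 0) + card (P - S)"

definition mak'_term :: "nat \<Rightarrow> (nat \<Rightarrow> nat) \<Rightarrow> nat set \<Rightarrow> nat \<Rightarrow> nat set \<Rightarrow> nat" where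
  "mak'_term k pos P x S =
     (if x \<in> P then card {y \<in> P \<inter> S. pos x < pos y} else 0) + card ({1..k} - insert x P)"

definition lsb_term :: "(nat \<Rightarrow> nat) \<Rightarrow> nat set \<Rightarrow> nat \<Rightarrow> nat set \<Rightarrow> nat" where
  "lsb_term pos P x S = (if x \<in> P then card {y \<in> P \<inter> S. pos y < pos x} else card (P \<inter> S))"

definition word_weight :: "nat \<Rightarrow> (nat \<Rightarrow> nat) \<Rightarrow> 'a::comm_semiring_1 \<Rightarrow> 'a \<Rightarrow> 'a \<Rightarrow> nat set \<Rightarrow> nat list \<Rightarrow> 'a" where
  "word_weight k pos p t q P xs =
     p ^ scan (mak_term pos) P xs * t ^ scan (mak'_term k pos) P xs * q ^ scan (lsb_term pos) P xs"

lemma word_weight_Cons: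
  "word_weight k pos p t q P (x # xs) =
     p ^ mak_term pos P x (set (x # xs)) * t ^ mak'_term k pos P x (set (x # xs)) *
     q ^ lsb_term pos P x (set (x # xs)) * word_weight k pos p t q (insert x P) xs"
  by (simp add: word_weight_def power_add mult_ac del: list.set)

text \<open>
  The suffixes after \<open>m\<close> blocks have been opened, such that \<open>A\<close> is the set of the blocks still
  active: the labels up to \<open>m\<close> that occur again.
\<close>
definition active_words :: "nat \<Rightarrow> nat \<Rightarrow> nat \<Rightarrow> nat set \<Rightarrow> nat list set" where
  "active_words k n m A = {xs \<in> growth_words k m n. set xs \<inter> {1..m} = A}"

abbreviation active_sum :: "nat \<Rightarrow> (nat \<Rightarrow> nat) \<Rightarrow> 'a::comm_semiring_1 \<Rightarrow> 'a \<Rightarrow> 'a \<Rightarrow> nat \<Rightarrow> nat \<Rightarrow> nat set \<Rightarrow> 'a" where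
  "active_sum k pos p t q n m A \<equiv> (\<Sum>xs\<in>active_words k n m A. word_weight k pos p t q {1..m} xs)"

lemma finite_active_words: "finite (active_words k n m A)"
  by (simp add: active_words_def finite_growth_words)

text \<open>
  A new label \<open>Suc m\<close> remains active exactly if it occurs in the tail, and an old label \<open>x\<close> is
  closed exactly if it does not.
\<close>
lemma active_words_heads:
  assumes "A \<subseteq> {1..m}"
  shows "active_words k (Suc n) m A =
     Cons (Suc m) ` (active_words k n (Suc m) A \<union> active_words k n (Suc m) (insert (Suc m) A)) \<union>
     (\<Union>x\<in>A. Cons x ` (active_words k n m A \<union> active_words k n m (A - {x})))" (is "?L = ?R")
proof -
  have nil: "[] \<notin> ?L" "[] \<notin> ?R"
    by (auto simp: active_words_def growth_words_def)
  have "x # xs \<in> ?L \<longleftrightarrow> x # xs \<in> ?R" for x xs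
  proof -
    have 1: "x # xs \<in> ?R \<longleftrightarrow>
       x = Suc m \<and> xs \<in> growth_words k (Suc m) n \<and> (set xs \<inter> {1..Suc m} = A \<or> set xs \<inter> {1..Suc m} = insert (Suc m) A) \<or>
       x \<in> A \<and> xs \<in> growth_words k m n \<and> (set xs \<inter> {1..m} = A \<or> set xs \<inter> {1..m} = A - {x})"
      by (auto simp: active_words_def)
    have Sm: "{1..Suc m} = insert (Suc m) {1..m}" "Suc m \<notin> {1..m}"
      by auto
    have 2: "(set xs \<inter> {1..Suc m} = A \<or> set xs \<inter> {1..Suc m} = insert (Suc m) A) \<longleftrightarrow> set xs \<inter> {1..m} = A"
    proof -
      have "Suc m \<notin> A" using assms by auto
      then show ?thesis unfolding Sm(1) using Sm(2)
        by (cases "Suc m \<in> set xs") (auto simp: insert_ident simp del: One_nat_def atLeastAtMost_iff)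
    qed
    have 3: "x \<in> A \<and> (set xs \<inter> {1..m} = A \<or> set xs \<inter> {1..m} = A - {x}) \<longleftrightarrow>
       x \<in> {1..m} \<and> set (x # xs) \<inter> {1..m} = A"
      using assms by auto
    have 4: "x = Suc m \<Longrightarrow> set (x # xs) \<inter> {1..m} = set xs \<inter> {1..m}"
      by auto
    have "x # xs \<in> ?L \<longleftrightarrow>
       (x = Suc m \<and> xs \<in> growth_words k (Suc m) n \<or> x \<in> {1..m} \<and> xs \<in> growth_words k m n) \<and>
       set (x # xs) \<inter> {1..m} = A"
      by (simp only: active_words_def Cons_in_growth_words mem_Collect_eq)
    also have "\<dots> \<longleftrightarrow>
       x = Suc m \<and> xs \<in> growth_words k (Suc m) n \<and> set xs \<inter> {1..m} = A \<or>
       xs \<in> growth_words k m n \<and> x \<in> {1..m} \<and> set (x # xs) \<inter> {1..m} = A"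
      using 4 by (cases "x = Suc m") (auto simp only: 4)
    also have "\<dots> \<longleftrightarrow> x # xs \<in> ?R"
      unfolding 1 2 3[symmetric] by (simp only: conj_ac)
    finally show ?thesis .
  qed
  note cons = this
  show ?thesis
  proof (rule set_eqI)
    fix ys show "ys \<in> ?L \<longleftrightarrow> ys \<in> ?R"
      using nil cons by (cases ys) (simp_all only:)
  qed
qed

lemma active_sum_Suc:
  assumes "A \<subseteq> {1..m}" "inj_on pos A"
  shows "active_sum k pos p t q (Suc n) m A =
     p ^ (m - card A) * t ^ (k - Suc m) * q ^ card A *
       (active_sum k pos p t q n (Suc m) A + active_sum k pos p t q n (Suc m) (insert (Suc m) A)) +
     (\<Sum>x\<in>A. p ^ (m - card A) * t ^ (k - m) * ((p * t) ^ card {y\<in>A. pos x < pos y} * q ^ card {y\<in>A. pos y < pos x}) *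
       (active_sum k pos p t q n m A + active_sum k pos p t q n m (A - {x})))"
proof -
  let ?W = "\<lambda>m. word_weight k pos p t q {1..m}"
  have finA: "finite A" using assms(1) finite_subset by blast
  have SucA: "Suc m \<notin> A" using assms(1) by auto
  have card_closed: "card ({1..m} - S) = m - card A" if "{1..m} \<inter> S = A" for S
    using that finA card_Diff_subset_Int[of "{1..m}" S] by simp
  have card_new: "card ({1..k} - {1..m}) = k - m" if "active_words k n m B \<noteq> {}" for m B
  proof -
    have "m \<le> k" using that growth_words_empty[of k m n] by (force simp: active_words_def)
    then show ?thesis by (subst card_Diff_subset) auto
  qed
  have new: "?W m (Suc m # xs) = p ^ (m - card A) * t ^ (k - Suc m) * q ^ card A * ?W (Suc m) xs"
    if "xs \<in> active_words k n (Suc m) A \<union> active_words k n (Suc m) (insert (Suc m) A)" for xs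
  proof -
    have S: "{1..m} \<inter> set (Suc m # xs) = A"
    proof -
      have "{1..m} \<inter> set (Suc m # xs) = set xs \<inter> {1..Suc m} - {Suc m}" by auto
      then show ?thesis using that SucA by (auto simp: active_words_def)
    qed
    have k: "card ({1..k} - {1..Suc m}) = k - Suc m"
      using that card_new by blast
    have ins: "insert (Suc m) {1..m} = {1..Suc m}" by auto
    show ?thesis
      unfolding word_weight_Cons mak_term_def mak'_term_def lsb_term_def S card_closed[OF S] ins k
      by simp
  qed
  have old: "?W m (x # xs) = p ^ (m - card A) * t ^ (k - m) *
      ((p * t) ^ card {y\<in>A. pos x < pos y} * q ^ card {y\<in>A. pos y < pos x}) * ?W m xs"
    if "x \<in> A" "xs \<in> active_words k n m A \<union> active_words k n m (A - {x})" for x xs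
  proof -
    have S: "{1..m} \<inter> set (x # xs) = A"
      using that assms(1) by (auto simp: active_words_def)
    have k: "card ({1..k} - {1..m}) = k - m"
      using that card_new by blast
    have ins: "insert x {1..m} = {1..m}" "x \<in> {1..m}" using that assms(1) by auto
    show ?thesis
      unfolding word_weight_Cons mak_term_def mak'_term_def lsb_term_def S card_closed[OF S] ins k
      using ins(2) by (simp add: power_add power_mult_distrib mult_ac)
  qed
  let ?N = "active_words k n (Suc m) A \<union> active_words k n (Suc m) (insert (Suc m) A)"
  let ?O = "\<lambda>x. active_words k n m A \<union> active_words k n m (A - {x})"
  have "active_sum k pos p t q (Suc n) m A =
      (\<Sum>xs\<in>Cons (Suc m) ` ?N. ?W m xs) + (\<Sum>xs\<in>(\<Union>x\<in>A. Cons x ` ?O x). ?W m xs)"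
    unfolding active_words_heads[OF assms(1)]
    by (rule sum.union_disjoint) (use finA SucA in \<open>auto simp: finite_active_words\<close>)
  also have "(\<Sum>xs\<in>(\<Union>x\<in>A. Cons x ` ?O x). ?W m xs) = (\<Sum>x\<in>A. \<Sum>xs\<in>Cons x ` ?O x. ?W m xs)"
    by (rule sum.UNION_disjoint) (use finA in \<open>auto simp: finite_active_words\<close>)
  also have "\<dots> = (\<Sum>x\<in>A. \<Sum>xs\<in>?O x. ?W m (x # xs))"
    by (simp add: sum.reindex)
  also have "\<dots> = (\<Sum>x\<in>A. p ^ (m - card A) * t ^ (k - m) *
      ((p * t) ^ card {y\<in>A. pos x < pos y} * q ^ card {y\<in>A. pos y < pos x}) * (\<Sum>xs\<in>?O x. ?W m xs))"
    unfolding sum_distrib_left by (intro sum.cong refl old)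
  also have "\<dots> = (\<Sum>x\<in>A. p ^ (m - card A) * t ^ (k - m) *
      ((p * t) ^ card {y\<in>A. pos x < pos y} * q ^ card {y\<in>A. pos y < pos x}) *
      (active_sum k pos p t q n m A + active_sum k pos p t q n m (A - {x})))"
  proof (rule sum.cong)
    fix x assume "x \<in> A"
    then have "active_words k n m A \<inter> active_words k n m (A - {x}) = {}"
      by (auto simp: active_words_def)
    then show "p ^ (m - card A) * t ^ (k - m) *
      ((p * t) ^ card {y\<in>A. pos x < pos y} * q ^ card {y\<in>A. pos y < pos x}) * (\<Sum>xs\<in>?O x. ?W m xs) =
      p ^ (m - card A) * t ^ (k - m) *
      ((p * t) ^ card {y\<in>A. pos x < pos y} * q ^ card {y\<in>A. pos y < pos x}) *
      (active_sum k pos p t q n m A + active_sum k pos p t q n m (A - {x}))"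
      by (simp add: sum.union_disjoint finite_active_words)
  qed simp
  also have "(\<Sum>xs\<in>Cons (Suc m) ` ?N. ?W m xs) = (\<Sum>xs\<in>?N. ?W m (Suc m # xs))"
    by (simp add: sum.reindex)
  also have "\<dots> = p ^ (m - card A) * t ^ (k - Suc m) * q ^ card A * (\<Sum>xs\<in>?N. ?W (Suc m) xs)"
    unfolding sum_distrib_left by (intro sum.cong refl new)
  also have "(\<Sum>xs\<in>?N. ?W (Suc m) xs) =
      active_sum k pos p t q n (Suc m) A + active_sum k pos p t q n (Suc m) (insert (Suc m) A)"
    by (rule sum.union_disjoint[OF finite_active_words finite_active_words])
      (use SucA in \<open>auto simp: active_words_def\<close>)
  finally show ?thesis .
qed

text \<open>
  The step weights of partitions. A down-step to height \<open>h\<close> starts from \<open>Suc h\<close> active blocks.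
\<close>
abbreviation level_weight :: "nat \<Rightarrow> 'a::comm_semiring_1 \<Rightarrow> 'a \<Rightarrow> 'a \<Rightarrow> nat \<times> nat \<Rightarrow> nat \<times> nat \<Rightarrow> 'a" where
  "level_weight k p t q \<equiv> step_weight k p t (power q) (pq_bracket (p * t) q) (power q)
     (\<lambda>h. pq_bracket (p * t) q (Suc h))"

text \<open>
  The positions of the active blocks enter only through \<open>sum_rank_weight\<close>, so that the sum
  over suffixes depends only on the number of active blocks.
\<close>
lemma active_sum_eq_walk:
  assumes "A \<subseteq> {1..m}" "m \<le> k" "inj_on pos {1..k}"
  shows "active_sum k pos p t q n m A =
         walk (levels k) (level_weight k p t q) n (card A, m - card A) (0, k)"
  using assms(1,2)
proof (induction n arbitrary: m A)
  case 0
  have fin: "finite A" using 0 finite_subset by blast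
  show ?case
  proof (cases "m = k \<and> A = {}")
    case True
    then have "active_words k 0 m A = {[]}"
      by (auto simp: active_words_def growth_words_0)
    with True show ?thesis by (simp add: word_weight_def)
  next
    case False
    then have "active_words k 0 m A = {}"
      by (auto simp: active_words_def growth_words_0)
    with False fin show ?thesis by auto
  qed
next
  case (Suc n)
  let ?w = "walk (levels k) (level_weight k p t q) n"
  let ?h = "card A" let ?c = "m - card A"
  have fin: "finite A" using Suc.prems finite_subset by blast
  have hm: "?h \<le> m" using card_mono[OF _ Suc.prems(1)] by simp
  have SucA: "Suc m \<notin> A" using Suc.prems(1) by auto
  have inj: "inj_on pos A"
    using Suc.prems by (intro inj_on_subset[OF assms(3)]) (meson atLeastatMost_subset_iff le_refl subset_trans)
  have new: "active_sum k pos p t q n (Suc m) A = ?w (?h, Suc ?c) (0, k)"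
    "active_sum k pos p t q n (Suc m) (insert (Suc m) A) = ?w (Suc ?h, ?c) (0, k)" if "m < k"
  proof -
    have "A \<subseteq> {1..Suc m}" using Suc.prems(1) by auto
    then show "active_sum k pos p t q n (Suc m) A = ?w (?h, Suc ?c) (0, k)"
      using Suc.IH[of A "Suc m"] that hm by (simp add: Suc_diff_le)
    show "active_sum k pos p t q n (Suc m) (insert (Suc m) A) = ?w (Suc ?h, ?c) (0, k)"
      using Suc.IH[of "insert (Suc m) A" "Suc m"] Suc.prems(1) that fin SucA by force
  qed
  have none: "active_words k n (Suc m) B = {}" if "\<not> m < k" for B
    using that growth_words_empty[of k "Suc m" n] by (auto simp: active_words_def)
  have del: "active_sum k pos p t q n m (A - {x}) = ?w (?h - 1, Suc ?c) (0, k)" if "x \<in> A" for x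
  proof -
    have "card A > 0" using that fin card_gt_0_iff by blast
    then have "m - card (A - {x}) = Suc ?c" using that fin hm by simp
    then show ?thesis
      using Suc.IH[of "A - {x}" m] Suc.prems that fin by auto
  qed
  have keep: "active_sum k pos p t q n m A = ?w (?h, ?c) (0, k)"
    using Suc.IH Suc.prems by blast
  have mk: "?h + ?c = m" using hm by simp
  have "(\<Sum>x\<in>A. p ^ ?c * t ^ (k - m) * ((p * t) ^ card {y\<in>A. pos x < pos y} * q ^ card {y\<in>A. pos y < pos x}) *
       (active_sum k pos p t q n m A + active_sum k pos p t q n m (A - {x}))) =
     (\<Sum>x\<in>A. ((p * t) ^ card {y\<in>A. pos x < pos y} * q ^ card {y\<in>A. pos y < pos x}) *
       (p ^ ?c * t ^ (k - m) * (?w (?h, ?c) (0, k) + ?w (?h - 1, Suc ?c) (0, k))))"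
    by (rule sum.cong) (simp_all only: keep del mult_ac)
  also have "\<dots> = pq_bracket (p * t) q ?h *
       (p ^ ?c * t ^ (k - m) * (?w (?h, ?c) (0, k) + ?w (?h - 1, Suc ?c) (0, k)))"
    unfolding sum_distrib_right[symmetric] sum_rank_weight[OF fin inj] ..
  also have "\<dots> = p ^ ?c * t ^ (k - (?h + ?c)) * (pq_bracket (p * t) q ?h * ?w (?h, ?c) (0, k) +
      (case ?h of 0 \<Rightarrow> 0 | Suc h' \<Rightarrow> pq_bracket (p * t) q (Suc h') * ?w (h', Suc ?c) (0, k)))"
    unfolding mk by (simp add: pq_bracket_0 algebra_simps split: nat.split)
  finally have old: "(\<Sum>x\<in>A. p ^ ?c * t ^ (k - m) * ((p * t) ^ card {y\<in>A. pos x < pos y} * q ^ card {y\<in>A. pos y < pos x}) *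
       (active_sum k pos p t q n m A + active_sum k pos p t q n m (A - {x}))) = \<dots>" .
  show ?case
    unfolding active_sum_Suc[OF Suc.prems(1) inj] old walk.simps(2)
      step_weight_sum_left[of ?h ?c k, unfolded mk, OF Suc.prems(2)]
    unfolding mk using new none by (cases "m < k") (simp_all add: algebra_simps)
qed

definition word_sum :: "nat \<Rightarrow> nat \<Rightarrow> (nat \<Rightarrow> nat) \<Rightarrow> 'a::comm_semiring_1 \<Rightarrow> 'a \<Rightarrow> 'a \<Rightarrow> 'a" where
  "word_sum n k pos p t q = (\<Sum>xs\<in>growth_words k 0 n. word_weight k pos p t q {} xs)"

lemma word_sum_eq_walk:
  assumes "inj_on pos {1..k}"
  shows "word_sum n k pos p t q = walk (levels k) (level_weight k p t q) n (0, 0) (0, k)"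
  using active_sum_eq_walk[of "{}" 0 k pos p t q n] assms by (simp add: word_sum_def active_words_def)

lemma word_sum_symmetric:
  assumes "inj_on pos {1..k}"
  shows "word_sum n k pos p t q = word_sum n k pos t p q"
  unfolding word_sum_eq_walk[OF assms]
  using walk_symmetric[of k p t "power q" "pq_bracket (p * t) q" "power q" "\<lambda>h. pq_bracket (p * t) q (Suc h)" n]
  by (simp add: mult.commute)

lemma word_sum_Stirling:
  assumes "inj_on pos {1..k}"
  shows "word_sum n k pos p 1 q = pq_Stirling p q n k"
  unfolding word_sum_eq_walk[OF assms] mult_1_right
  using walk_closed_form[of 0 k k p q n] by (simp add: bin_weight_0 pq_Stirling_eq mult.commute)

section \<open>Statistics of partitions in terms of growth words\<close>

lemma card_filter_complementary:
  assumes "finite A" "\<And>x. x \<in> A \<Longrightarrow> P x \<longleftrightarrow> \<not> Q x"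
  shows "card {x \<in> A. P x} + card {x \<in> A. Q x} = card A"
proof -
  have "card {x \<in> A. P x} + card {x \<in> A. Q x} = card ({x \<in> A. P x} \<union> {x \<in> A. Q x})"
    using assms by (intro card_Un_disjoint[symmetric]) auto
  also have "{x \<in> A. P x} \<union> {x \<in> A. Q x} = A"
    using assms(2) by blast
  finally show ?thesis .
qed

text \<open>
  The block with label \<open>l\<close>. Elements of the ground set start from \<open>1\<close>, list indices from \<open>0\<close>.
\<close>
definition letter_positions :: "nat list \<Rightarrow> nat \<Rightarrow> nat set" where
  "letter_positions xs l = {i \<in> {1..length xs}. xs ! (i - 1) = l}"

text \<open>
  The \<open>\<sigma>\<close>-partition of a growth word.
\<close>
definition word_partition :: "nat \<Rightarrow> (nat \<Rightarrow> nat) \<Rightarrow> nat list \<Rightarrow> ordered_partition" where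
  "word_partition k \<sigma> xs = map (\<lambda>i. letter_positions xs (\<sigma> i)) [1..<Suc k]"

text \<open>
  For an element \<open>i\<close> of the ground set, \<open>opened i\<close> contains the labels of the blocks with minimum less
  than \<open>i\<close> (\<open>opened_eq\<close>) and \<open>pending i\<close> those with maximum at least \<open>i\<close> (\<open>pending_eq\<close>). As block \<open>l\<close>
  stands where \<open>\<sigma>\<close> takes the value \<open>l\<close>, its position is \<open>inv \<sigma> l\<close>.
\<close>
locale growth_word =
  fixes n k :: nat and \<sigma> :: "nat \<Rightarrow> nat" and xs :: "nat list"
  assumes perm: "\<sigma> permutes {1..k}" and word: "xs \<in> growth_words k 0 n"
begin

abbreviation label :: "nat \<Rightarrow> nat" where "label i \<equiv> xs ! (i - 1)"
abbreviation pos :: "nat \<Rightarrow> nat" where "pos \<equiv> inv \<sigma>"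
abbreviation blk :: "nat \<Rightarrow> nat set" where "blk \<equiv> letter_positions xs"
abbreviation opened :: "nat \<Rightarrow> nat set" where "opened i \<equiv> set (take (i - 1) xs)"
abbreviation pending :: "nat \<Rightarrow> nat set" where "pending i \<equiv> set (drop (i - 1) xs)"
abbreviation part :: ordered_partition where "part \<equiv> word_partition k \<sigma> xs"

lemma length_xs: "length xs = n" and set_xs: "set xs = {1..k}"
  and growth: "\<And>i. i < n \<Longrightarrow> {1..<xs ! i} \<subseteq> set (take i xs)"
  using word by (auto simp: growth_words_def)

lemma label_in: "i \<in> {1..n} \<Longrightarrow> label i \<in> {1..k}"
  using nth_mem[of "i - 1" xs] unfolding set_xs length_xs by auto

lemma mem_blk: "i \<in> blk l \<longleftrightarrow> i \<in> {1..n} \<and> label i = l"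
  by (auto simp: letter_positions_def length_xs)

lemma finite_blk: "finite (blk l)"
  by (simp add: letter_positions_def)

lemma blk_nonempty: "l \<in> {1..k} \<Longrightarrow> blk l \<noteq> {}"
proof -
  assume "l \<in> {1..k}"
  then obtain j where "j < n" "xs ! j = l"
    unfolding set_xs[symmetric] length_xs[symmetric] by (auto simp: in_set_conv_nth)
  then have "Suc j \<in> blk l" by (simp add: mem_blk)
  then show ?thesis by blast
qed

lemma Min_blk: "l \<in> {1..k} \<Longrightarrow> Min (blk l) \<in> {1..n} \<and> label (Min (blk l)) = l"
  using Min_in[OF finite_blk blk_nonempty] mem_blk by blast

lemma Max_blk: "l \<in> {1..k} \<Longrightarrow> Max (blk l) \<in> {1..n} \<and> label (Max (blk l)) = l"
  using Max_in[OF finite_blk blk_nonempty] mem_blk by blast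

lemma Min_blk_le: "i \<in> {1..n} \<Longrightarrow> Min (blk (label i)) \<le> i"
  and Max_blk_ge: "i \<in> {1..n} \<Longrightarrow> i \<le> Max (blk (label i))"
  by (simp_all add: finite_blk mem_blk)

lemma opened_eq:
  assumes "i \<in> {1..n}"
  shows "opened i = {l \<in> {1..k}. Min (blk l) < i}"
proof -
  have "l \<in> opened i \<longleftrightarrow> l \<in> {1..k} \<and> Min (blk l) < i" for l
  proof
    assume "l \<in> opened i"
    then obtain j where j: "j < i - 1" "j < n" "xs ! j = l"
      by (auto simp: in_set_conv_nth length_xs)
    then have "Suc j \<in> {1..n}" "label (Suc j) = l" by auto
    then show "l \<in> {1..k} \<and> Min (blk l) < i"
      using label_in Min_blk_le[of "Suc j"] j(1) by fastforce
  next
    assume l: "l \<in> {1..k} \<and> Min (blk l) < i"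
    then have "Min (blk l) - 1 < i - 1" "Min (blk l) - 1 < n" "label (Min (blk l)) = l"
      using Min_blk[of l] assms by auto
    then show "l \<in> opened i"
      by (metis in_set_conv_nth length_take length_xs min_less_iff_conj nth_take)
  qed
  then show ?thesis by blast
qed

lemma pending_eq:
  assumes "i \<in> {1..n}"
  shows "pending i = {l \<in> {1..k}. i \<le> Max (blk l)}"
proof -
  have "l \<in> pending i \<longleftrightarrow> l \<in> {1..k} \<and> i \<le> Max (blk l)" for l
  proof
    assume "l \<in> pending i"
    then obtain j where "j < n - (i - 1)" "drop (i - 1) xs ! j = l"
      by (auto simp: in_set_conv_nth length_xs)
    then have j: "i + j \<in> {1..n}" "label (i + j) = l"
      using assms by (auto simp: length_xs)
    then show "l \<in> {1..k} \<and> i \<le> Max (blk l)"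
      using label_in[OF j(1)] Max_blk_ge[OF j(1)] by (metis add_leD1)
  next
    assume l: "l \<in> {1..k} \<and> i \<le> Max (blk l)"
    define j where "j = Max (blk l) - i"
    have "i - 1 + j < n" "xs ! (i - 1 + j) = l"
      using Max_blk[of l] l assms by (auto simp: j_def)
    then show "l \<in> pending i"
      by (auto simp: in_set_conv_nth length_xs intro!: exI[of _ j])
  qed
  then show ?thesis by blast
qed

lemma Min_blk_less:
  assumes "l \<in> {1..k}" "l' \<in> {1..k}"
  shows "Min (blk l) < Min (blk l') \<longleftrightarrow> l < l'"
proof -
  have less: "Min (blk l) < Min (blk l')" if "l < l'" "l \<in> {1..k}" "l' \<in> {1..k}" for l l'
  proof -
    have "Min (blk l') \<in> {1..n}" "label (Min (blk l')) = l'" using Min_blk that by auto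
    then have "l \<in> opened (Min (blk l'))"
      using growth[of "Min (blk l') - 1"] that by fastforce
    then show ?thesis
      using opened_eq[OF \<open>Min (blk l') \<in> {1..n}\<close>] by blast
  qed
  show ?thesis
    using less[of l l'] less[of l' l] assms by (metis less_asym linorder_neqE_nat less_irrefl)
qed

lemma sigma_partition: "part \<in> sigma_partitions n k \<sigma>"
proof -
  have "partition_on {1..n} (blk ` {1..k})"
  proof (rule partition_onI)
    show "\<Union> (blk ` {1..k}) = {1..n}"
      using label_in mem_blk by (auto simp: set_eq_iff simp del: atLeastAtMost_iff)
    show "disjnt p q" if "p \<in> blk ` {1..k}" "q \<in> blk ` {1..k}" "p \<noteq> q" for p q
      using that by (auto simp: disjnt_def mem_blk)
    show "{} \<notin> blk ` {1..k}"
      using blk_nonempty by (metis imageE)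
  qed
  moreover have "strict_mono_on {1..k} (\<lambda>l. Min (blk l))"
    using Min_blk_less by (intro strict_mono_onI) blast
  ultimately show ?thesis
    unfolding sigma_partitions_def word_partition_def by blast
qed

lemma pos_in: "l \<in> {1..k} \<Longrightarrow> pos l \<in> {1..k}"
  using permutes_in_image[OF permutes_inv[OF perm]] by blast

lemma sigma_pos: "\<sigma> (pos l) = l" and pos_sigma: "pos (\<sigma> i) = i"
  using permutes_inverses[OF perm] by auto

lemma pos_inj: "pos l = pos l' \<longleftrightarrow> l = l'"
  by (metis sigma_pos)

lemma pos_order: "l \<noteq> l' \<Longrightarrow> pos l < pos l' \<longleftrightarrow> \<not> pos l' < pos l"
  using pos_inj[of l l'] by linarith

lemma card_split_around:
  assumes "finite A" "y \<notin> A"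
  shows "card A = card {l \<in> A. pos l < pos y} + card {l \<in> A. pos y < pos l}"
proof (rule card_filter_complementary[symmetric, OF assms(1)])
  fix l assume "l \<in> A"
  then have "l \<noteq> y" using assms(2) by blast
  then show "pos l < pos y \<longleftrightarrow> \<not> pos y < pos l" by (rule pos_order)
qed

lemma length_part: "length part = k"
  by (simp add: word_partition_def del: upt_Suc)

lemma part_nth: "m < k \<Longrightarrow> part ! m = blk (\<sigma> (Suc m))"
  by (simp add: word_partition_def del: upt_Suc)

lemma part_nth_pos: "l \<in> {1..k} \<Longrightarrow> part ! (pos l - 1) = blk l"
  using part_nth[of "pos l - 1"] pos_in[of l] sigma_pos by auto

lemma set_part: "set part = blk ` {1..k}"
proof -
  have "set part = (\<lambda>i. blk (\<sigma> i)) ` {1..k}"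
    by (simp add: word_partition_def atLeastLessThanSuc_atLeastAtMost del: upt_Suc)
  also have "\<dots> = blk ` \<sigma> ` {1..k}" by (rule image_image[symmetric])
  finally show ?thesis by (simp only: permutes_image[OF perm])
qed

lemma Union_part: "\<Union> (set part) = {1..n}"
  unfolding set_part using label_in mem_blk by (auto simp: set_eq_iff simp del: atLeastAtMost_iff)

lemma block_index_part:
  assumes "i \<in> {1..n}"
  shows "block_index part i = pos (label i) - 1"
  unfolding block_index_def length_part
proof (rule the_equality)
  show "pos (label i) - 1 < k \<and> i \<in> part ! (pos (label i) - 1)"
    using pos_in[OF label_in[OF assms]] label_in[OF assms] part_nth_pos assms mem_blk by auto
  show "m = pos (label i) - 1" if "m < k \<and> i \<in> part ! m" for m
    using that part_nth[of m] mem_blk pos_sigma by auto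
qed

lemma block_index_less:
  assumes "i \<in> {1..n}" "j \<in> {1..n}"
  shows "block_index part i < block_index part j \<longleftrightarrow> pos (label i) < pos (label j)"
proof -
  have "a - 1 < b - 1 \<longleftrightarrow> a < b" if "a \<in> {1..k}" "b \<in> {1..k}" for a b :: nat
    using that by auto
  then show ?thesis
    unfolding block_index_part[OF assms(1)] block_index_part[OF assms(2)]
    using pos_in label_in assms by blast
qed

lemma block_index_less_Min:
    "i \<in> {1..n} \<Longrightarrow> l \<in> {1..k} \<Longrightarrow> block_index part i < block_index part (Min (blk l)) \<longleftrightarrow> pos (label i) < pos l"
  and block_index_Min_less:
    "i \<in> {1..n} \<Longrightarrow> l \<in> {1..k} \<Longrightarrow> block_index part (Min (blk l)) < block_index part i \<longleftrightarrow> pos l < pos (label i)"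
  and block_index_less_Max:
    "i \<in> {1..n} \<Longrightarrow> l \<in> {1..k} \<Longrightarrow> block_index part i < block_index part (Max (blk l)) \<longleftrightarrow> pos (label i) < pos l"
  and block_index_Max_less:
    "i \<in> {1..n} \<Longrightarrow> l \<in> {1..k} \<Longrightarrow> block_index part (Max (blk l)) < block_index part i \<longleftrightarrow> pos l < pos (label i)"
  using block_index_less Min_blk Max_blk by metis+

lemma card_openers:
  "card {j \<in> openers part. Q j} = card {l \<in> {1..k}. Q (Min (blk l))}"
proof -
  have "{j \<in> openers part. Q j} = (\<lambda>l. Min (blk l)) ` {l \<in> {1..k}. Q (Min (blk l))}"
    by (auto simp: openers_def set_part)
  moreover have "inj_on (\<lambda>l. Min (blk l)) {l \<in> {1..k}. Q (Min (blk l))}"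
    by (rule inj_on_inverseI[of _ label]) (use Min_blk in auto)
  ultimately show ?thesis by (simp add: card_image)
qed

lemma card_closers:
  "card {j \<in> closers part. Q j} = card {l \<in> {1..k}. Q (Max (blk l))}"
proof -
  have "{j \<in> closers part. Q j} = (\<lambda>l. Max (blk l)) ` {l \<in> {1..k}. Q (Max (blk l))}"
    by (auto simp: closers_def set_part)
  moreover have "inj_on (\<lambda>l. Max (blk l)) {l \<in> {1..k}. Q (Max (blk l))}"
    by (rule inj_on_inverseI[of _ label]) (use Max_blk in auto)
  ultimately show ?thesis by (simp add: card_image)
qed

text \<open>
  The numbers of active blocks to the right and to the left of the block of \<open>i\<close>.
\<close>
definition right :: "nat \<Rightarrow> nat" where
  "right i = card {l \<in> opened i \<inter> pending i. pos (label i) < pos l}"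

definition left :: "nat \<Rightarrow> nat" where
  "left i = card {l \<in> opened i \<inter> pending i. pos l < pos (label i)}"

lemma label_pending: "i \<in> {1..n} \<Longrightarrow> label i \<in> pending i"
  using pending_eq label_in Max_blk_ge by blast

lemma not_pending: "i \<in> {1..n} \<Longrightarrow> l \<in> {1..k} \<Longrightarrow> l \<notin> pending i \<longleftrightarrow> Max (blk l) < i"
  using pending_eq by auto

lemma not_pending_opened: "i \<in> {1..n} \<Longrightarrow> l \<in> {1..k} \<Longrightarrow> l \<notin> pending i \<Longrightarrow> l \<in> opened i"
  using not_pending[of i l] opened_eq[of i] Min_le[OF finite_blk Max_in[OF finite_blk blk_nonempty], of l]
    le_less_trans[of "Min (blk l)" "Max (blk l)" i] by blast

lemma closed_eq:
  assumes "i \<in> {1..n}"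
  shows "opened i - pending i = {l \<in> {1..k}. Max (blk l) < i}"
  using not_pending[OF assms] not_pending_opened[OF assms] opened_eq[OF assms] by blast

text \<open>
  All closed blocks are counted, those on the right by \<open>ros\<close> and those on the left by \<open>lcs\<close>.
\<close>
lemma MAK_part: "MAK part = (\<Sum>i\<in>{1..n}. right i + card (opened i - pending i))"
proof -
  have "card {j \<in> openers part. j < i \<and> block_index part j > block_index part i} +
        card {j \<in> closers part. j < i \<and> block_index part j < block_index part i} =
        right i + card (opened i - pending i)" if i: "i \<in> {1..n}" for i
  proof -
    have "{l \<in> {1..k}. Min (blk l) < i \<and> block_index part i < block_index part (Min (blk l))} =
        {l \<in> opened i. pos (label i) < pos l}"
      by (auto simp: block_index_less_Min[OF i] opened_eq[OF i] simp del: One_nat_def atLeastAtMost_iff)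
    moreover have "{l \<in> {1..k}. Max (blk l) < i \<and> block_index part (Max (blk l)) < block_index part i} =
        {l \<in> opened i - pending i. pos l < pos (label i)}"
      unfolding closed_eq[OF i]
      by (auto simp: block_index_Max_less[OF i] simp del: One_nat_def atLeastAtMost_iff)
    moreover have "card {l \<in> opened i. pos (label i) < pos l} =
        right i + card {l \<in> opened i - pending i. pos (label i) < pos l}"
    proof -
      have "{l \<in> opened i. pos (label i) < pos l} = {l \<in> opened i \<inter> pending i. pos (label i) < pos l} \<union>
          {l \<in> opened i - pending i. pos (label i) < pos l}"
        by blast
      then show ?thesis
        unfolding right_def by (simp only:) (rule card_Un_disjoint, auto)
    qed
    moreover have "card (opened i - pending i) =
        card {l \<in> opened i - pending i. pos l < pos (label i)} +
        card {l \<in> opened i - pending i. pos (label i) < pos l}"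
      using label_pending[OF i] by (intro card_split_around) simp_all
    ultimately show ?thesis
      unfolding card_openers card_closers by simp
  qed
  then show ?thesis
    by (simp add: MAK_def ros_def lcs_def Union_part sum.distrib[symmetric])
qed

text \<open>
  All unopened blocks are counted, those on the left by \<open>lob\<close> and those on the right by \<open>rcb\<close>,
  which also counts the active blocks on the right.
\<close>
lemma MAK'_part: "MAK' part = (\<Sum>i\<in>{1..n}. right i + card ({1..k} - insert (label i) (opened i)))"
proof -
  have "card {j \<in> openers part. j > i \<and> block_index part j < block_index part i} +
        card {j \<in> closers part. j > i \<and> block_index part j > block_index part i} =
        right i + card ({1..k} - insert (label i) (opened i))" if i: "i \<in> {1..n}" for i
  proof -
    let ?N = "{1..k} - insert (label i) (opened i)"
    have N: "Min (blk l) > i \<longleftrightarrow> l \<in> ?N" if "l \<in> {1..k}" for l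
    proof (cases "l = label i")
      case True
      then show ?thesis using Min_blk_le[OF i] by auto
    next
      case False
      then have "Min (blk l) \<noteq> i" using Min_blk[OF that] by auto
      then show ?thesis
        unfolding opened_eq[OF i] using that False by (simp add: nat_neq_iff not_less) linarith
    qed
    have lo: "{l \<in> {1..k}. i < Min (blk l) \<and> block_index part (Min (blk l)) < block_index part i} =
        {l \<in> ?N. pos l < pos (label i)}"
      by (auto simp: block_index_Min_less[OF i] N simp del: One_nat_def atLeastAtMost_iff)
    have Max: "Max (blk l) > i \<and> pos (label i) < pos l \<longleftrightarrow>
        (l \<in> ?N \<or> l \<in> opened i \<inter> pending i) \<and> pos (label i) < pos l" if l: "l \<in> {1..k}" for l
    proof (cases "l = label i")
      case False
      then have "Max (blk l) \<noteq> i" using Max_blk[OF l] by auto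
      moreover have "Max (blk l) < i \<Longrightarrow> l \<in> opened i" using not_pending_opened[OF i l] not_pending[OF i l] by blast
      ultimately show ?thesis
        using not_pending[OF i l] l False by (auto simp: nat_neq_iff)
    qed auto
    have rc: "{l \<in> {1..k}. i < Max (blk l) \<and> block_index part i < block_index part (Max (blk l))} =
        {l \<in> ?N. pos (label i) < pos l} \<union> {l \<in> opened i \<inter> pending i. pos (label i) < pos l}"
    proof (rule set_eqI)
      fix l
      show "l \<in> {l \<in> {1..k}. i < Max (blk l) \<and> block_index part i < block_index part (Max (blk l))} \<longleftrightarrow>
        l \<in> {l \<in> ?N. pos (label i) < pos l} \<union> {l \<in> opened i \<inter> pending i. pos (label i) < pos l}"
      proof (cases "l \<in> {1..k}")
        case True
        then show ?thesis
          unfolding mem_Collect_eq Un_iff block_index_less_Max[OF i True] Max[OF True] by blast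
      next
        case False
        then show ?thesis
          using opened_eq[OF i] by blast
      qed
    qed
    have "card ({l \<in> ?N. pos (label i) < pos l} \<union> {l \<in> opened i \<inter> pending i. pos (label i) < pos l}) =
        card {l \<in> ?N. pos (label i) < pos l} + right i"
      unfolding right_def by (rule card_Un_disjoint) auto
    moreover have "card ?N = card {l \<in> ?N. pos l < pos (label i)} + card {l \<in> ?N. pos (label i) < pos l}"
      by (intro card_split_around) simp_all
    ultimately show ?thesis
      unfolding card_openers card_closers lo rc by simp
  qed
  then show ?thesis
    by (simp add: MAK'_def lob_def rcb_def Union_part sum.distrib[symmetric])
qed

lemma lsb_part: "lsb part = (\<Sum>i\<in>{1..n}. left i)"
  unfolding lsb_def Union_part
proof (rule sum.cong)
  fix i assume i: "i \<in> {1..n}"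
  let ?L = "{l \<in> opened i \<inter> pending i. pos l < pos (label i)}"
  have "{m. m < block_index part i \<and> Min (part ! m) < i \<and> Max (part ! m) > i} = (\<lambda>l. pos l - 1) ` ?L"
  proof (intro equalityI subsetI)
    fix m assume "m \<in> {m. m < block_index part i \<and> Min (part ! m) < i \<and> Max (part ! m) > i}"
    then have m: "m < pos (label i) - 1" "Min (part ! m) < i" "Max (part ! m) > i"
      using block_index_part[OF i] by auto
    then have "m < k" using pos_in[OF label_in[OF i]] by auto
    then have "\<sigma> (Suc m) \<in> {1..k}" using permutes_in_image[OF perm, of "Suc m"] by auto
    then have "\<sigma> (Suc m) \<in> ?L"
      using m part_nth[OF \<open>m < k\<close>] opened_eq[OF i] pending_eq[OF i] by (auto simp: pos_sigma)
    then show "m \<in> (\<lambda>l. pos l - 1) ` ?L"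
      by (rule rev_image_eqI) (simp add: pos_sigma)
  next
    fix m assume "m \<in> (\<lambda>l. pos l - 1) ` ?L"
    then obtain l where l: "m = pos l - 1" "l \<in> ?L" by blast
    then have k: "l \<in> {1..k}" using opened_eq[OF i] by blast
    then have "Max (blk l) \<noteq> i" using Max_blk[OF k] l by auto
    then show "m \<in> {m. m < block_index part i \<and> Min (part ! m) < i \<and> Max (part ! m) > i}"
      using l part_nth_pos[OF k] block_index_part[OF i] opened_eq[OF i] pending_eq[OF i] pos_in[OF k] by auto
  qed
  moreover have "inj_on (\<lambda>l. pos l - 1) ?L"
  proof (rule inj_onI)
    fix l l' assume "l \<in> ?L" "l' \<in> ?L" "pos l - 1 = pos l' - 1"
    moreover from this have "pos l \<in> {1..k}" "pos l' \<in> {1..k}"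
      using opened_eq[OF i] pos_in by blast+
    ultimately have "pos l = pos l'" by auto
    then show "l = l'" by (simp add: pos_inj)
  qed
  ultimately show "card {m. m < block_index part i \<and> Min (part ! m) < i \<and> Max (part ! m) > i} = left i"
    by (simp add: card_image left_def)
qed simp

lemma sum_openers:
  "(\<Sum>i\<in>{i \<in> {1..n}. label i \<notin> opened i}. g i) = (\<Sum>l\<in>{1..k}. g (Min (blk l)))"
proof -
  have "{i \<in> {1..n}. label i \<notin> opened i} = (\<lambda>l. Min (blk l)) ` {1..k}"
  proof (intro equalityI subsetI)
    fix i assume i: "i \<in> {i \<in> {1..n}. label i \<notin> opened i}"
    then have "i = Min (blk (label i))"
      using opened_eq[of i] label_in[of i] Min_blk_le[of i] by auto
    then show "i \<in> (\<lambda>l. Min (blk l)) ` {1..k}"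
      using label_in[of i] i by blast
  next
    fix i assume "i \<in> (\<lambda>l. Min (blk l)) ` {1..k}"
    then show "i \<in> {i \<in> {1..n}. label i \<notin> opened i}"
      using Min_blk opened_eq by fastforce
  qed
  moreover have "inj_on (\<lambda>l. Min (blk l)) {1..k}"
    by (rule inj_on_inverseI[of _ label]) (use Min_blk in auto)
  ultimately show ?thesis by (simp add: sum.reindex)
qed

lemma bInv_part:
  "bInv part = (\<Sum>l\<in>{1..k}. card {l' \<in> {1..k}. pos l < pos l' \<and> Max (blk l') < Min (blk l)})"
proof -
  let ?X = "SIGMA l:{1..k}. {l' \<in> {1..k}. pos l < pos l' \<and> Max (blk l') < Min (blk l)}"
  have "bij_betw (\<lambda>(i, j). (\<sigma> (Suc i), \<sigma> (Suc j)))
     {(i, j). i < j \<and> j < length part \<and> Min (part ! i) > Max (part ! j)} ?X"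
  proof (rule bij_betw_byWitness[where f' = "\<lambda>(l, l'). (pos l - 1, pos l' - 1)"])
    show "(\<lambda>(i, j). (\<sigma> (Suc i), \<sigma> (Suc j))) `
       {(i, j). i < j \<and> j < length part \<and> Min (part ! i) > Max (part ! j)} \<subseteq> ?X"
    proof (rule image_subsetI)
      fix x assume "x \<in> {(i, j). i < j \<and> j < length part \<and> Min (part ! i) > Max (part ! j)}"
      then obtain i j where x: "x = (i, j)" and
        ij: "i < j" "j < length part" "Max (part ! j) < Min (part ! i)" by blast
      then have "\<sigma> (Suc i) \<in> {1..k}" "\<sigma> (Suc j) \<in> {1..k}"
        using permutes_in_image[OF perm] by (auto simp: length_part)
      then show "(\<lambda>(i, j). (\<sigma> (Suc i), \<sigma> (Suc j))) x \<in> ?X"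
        using ij part_nth[of i] part_nth[of j]
        by (simp add: x length_part pos_sigma del: atLeastAtMost_iff)
    qed
    show "(\<lambda>(l, l'). (pos l - 1, pos l' - 1)) ` ?X \<subseteq>
       {(i, j). i < j \<and> j < length part \<and> Min (part ! i) > Max (part ! j)}"
    proof clarify
      fix l l' assume l: "l \<in> {1..k}" "l' \<in> {1..k}" and "pos l < pos l'" "Max (blk l') < Min (blk l)"
      then show "pos l - 1 < pos l' - 1 \<and> pos l' - 1 < length part \<and>
          Max (part ! (pos l' - 1)) < Min (part ! (pos l - 1))"
        using pos_in[OF l(1)] pos_in[OF l(2)] part_nth_pos l by (auto simp: length_part)
    qed
    show "\<forall>a\<in>?X. (case case a of (l, l') \<Rightarrow> (pos l - 1, pos l' - 1) of (i, j) \<Rightarrow> (\<sigma> (Suc i), \<sigma> (Suc j))) = a"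
    proof clarify
      fix l l' assume l: "l \<in> {1..k}" "l' \<in> {1..k}"
      then have "Suc (pos l - 1) = pos l" "Suc (pos l' - 1) = pos l'"
        using pos_in by fastforce+
      then show "\<sigma> (Suc (pos l - 1)) = l \<and> \<sigma> (Suc (pos l' - 1)) = l'"
        by (simp add: sigma_pos)
    qed
  qed (auto simp: pos_sigma)
  then have "bInv part = card ?X"
    unfolding bInv_def by (rule bij_betw_same_card)
  then show ?thesis by simp
qed

lemma perm_inv_eq: "perm_inv k \<sigma> = (\<Sum>l\<in>{1..k}. card {l' \<in> {1..k}. l' < l \<and> pos l < pos l'})"
proof -
  let ?X = "SIGMA l:{1..k}. {l' \<in> {1..k}. l' < l \<and> pos l < pos l'}"
  have "bij_betw (\<lambda>(i, j). (\<sigma> i, \<sigma> j)) {(i, j). i \<in> {1..k} \<and> j \<in> {1..k} \<and> i < j \<and> \<sigma> i > \<sigma> j} ?X"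
    by (rule bij_betw_byWitness[where f' = "\<lambda>(l, l'). (pos l, pos l')"])
      (use permutes_in_image[OF perm] pos_in in \<open>auto simp: sigma_pos pos_sigma simp del: atLeastAtMost_iff\<close>)
  then have "perm_inv k \<sigma> = card ?X"
    unfolding perm_inv_def by (rule bij_betw_same_card)
  then show ?thesis by simp
qed

text \<open>
  The blocks opened before the opener of block \<open>l\<close> are those with a smaller label. Among those to the
  right of block \<open>l\<close>, which are the inversions of \<open>\<sigma>\<close>, the closed ones are counted by \<open>bInv\<close> and
  the active ones by \<open>right\<close>.
\<close>
lemma bInv_perm_inv:
  "bInv part + (\<Sum>i\<in>{i \<in> {1..n}. label i \<notin> opened i}. right i) = perm_inv k \<sigma>"
  unfolding sum_openers bInv_part perm_inv_eq sum.distrib[symmetric]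
proof (rule sum.cong)
  fix l assume l: "l \<in> {1..k}"
  let ?i = "Min (blk l)"
  have i: "?i \<in> {1..n}" "label ?i = l" using Min_blk[OF l] by auto
  have "{l' \<in> {1..k}. l' < l \<and> pos l < pos l'} =
      {l' \<in> {1..k}. pos l < pos l' \<and> Max (blk l') < ?i} \<union> {l' \<in> opened ?i \<inter> pending ?i. pos l < pos l'}"
    using Min_blk_less[OF _ l] opened_eq[OF i(1)] not_pending[OF i(1)] not_pending_opened[OF i(1)] by blast
  moreover have "{l' \<in> {1..k}. pos l < pos l' \<and> Max (blk l') < ?i} \<inter>
      {l' \<in> opened ?i \<inter> pending ?i. pos l < pos l'} = {}"
    using not_pending[OF i(1)] by blast
  ultimately show "card {l' \<in> {1..k}. pos l < pos l' \<and> Max (blk l') < ?i} + right ?i =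
      card {l' \<in> {1..k}. l' < l \<and> pos l < pos l'}"
    unfolding right_def i(2) by (simp add: card_Un_disjoint)
qed simp

lemma scan_word: "scan e {} xs = (\<Sum>i\<in>{1..n}. e (opened i) (label i) (pending i))"
  by (simp add: scan_eq_sum length_xs sum.atLeast1_atMost_eq)

lemma sum_split_openers:
  fixes g h :: "nat \<Rightarrow> nat"
  shows "(\<Sum>i\<in>{1..n}. (if label i \<in> opened i then g i else 0) + h i) +
    (\<Sum>i\<in>{i \<in> {1..n}. label i \<notin> opened i}. g i) = (\<Sum>i\<in>{1..n}. g i + h i)"
  by (subst sum.inter_filter) (auto simp: sum.distrib[symmetric] intro!: sum.cong)

lemma MAK_bInv_eq: "MAK part + bInv part = perm_inv k \<sigma> + scan (mak_term pos) {} xs"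
  unfolding MAK_part bInv_perm_inv[symmetric] scan_word mak_term_def right_def[symmetric]
  using sum_split_openers[of right "\<lambda>i. card (opened i - pending i)"]
  by linarith

lemma MAK'_bInv_eq: "MAK' part + bInv part = perm_inv k \<sigma> + scan (mak'_term k pos) {} xs"
  unfolding MAK'_part bInv_perm_inv[symmetric] scan_word mak'_term_def right_def[symmetric]
  using sum_split_openers[of right "\<lambda>i. card ({1..k} - insert (label i) (opened i))"]
  by linarith

lemma cinvLSB_eq: "cinvLSB part + perm_inv k \<sigma> = k * (k - 1) + scan (lsb_term pos) {} xs"
proof -
  \<comment> \<open>The block of an opener is not active, so every active block lies on one of its sides.\<close>
  have lr: "left i + right i = card (opened i \<inter> pending i)" if "label i \<notin> opened i" for i
    unfolding left_def right_def
    using that by (intro card_split_around[symmetric]) simp_all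
  have "(\<Sum>i\<in>{1..n}. left i) + (\<Sum>i\<in>{i \<in> {1..n}. label i \<notin> opened i}. right i) =
      (\<Sum>i\<in>{1..n}. left i + (if label i \<notin> opened i then right i else 0))"
    by (subst sum.inter_filter) (auto simp: sum.distrib)
  also have "\<dots> = scan (lsb_term pos) {} xs"
    unfolding scan_word lsb_term_def left_def[symmetric]
    by (intro sum.cong refl) (simp add: lr del: One_nat_def)
  finally have "lsb part + (\<Sum>i\<in>{i \<in> {1..n}. label i \<notin> opened i}. right i) = scan (lsb_term pos) {} xs"
    by (simp only: lsb_part)
  moreover have "2 * (k choose 2) = k * (k - 1)"
    by (cases k) (simp_all add: choose_two)
  ultimately show ?thesis
    using bInv_le[of part] bInv_perm_inv unfolding cinvLSB_def cbInv_def length_part by linarith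
qed

end

lemma bij_word_partition:
  assumes perm: "\<sigma> permutes {1..k}"
  shows "bij_betw (word_partition k \<sigma>) (growth_words k 0 n) (sigma_partitions n k \<sigma>)"
  unfolding bij_betw_def
proof (intro conjI inj_onI equalityI subsetI)
  fix xs ys assume x: "xs \<in> growth_words k 0 n" and y: "ys \<in> growth_words k 0 n"
    and eq: "word_partition k \<sigma> xs = word_partition k \<sigma> ys"
  interpret x: growth_word n k \<sigma> xs by unfold_locales (use perm x in auto)
  interpret y: growth_word n k \<sigma> ys by unfold_locales (use perm y in auto)
  have "letter_positions xs l = letter_positions ys l" if "l \<in> {1..k}" for l
    using eq x.part_nth_pos[OF that] y.part_nth_pos[OF that] by simp
  then have "ys ! i = xs ! i" if "i < n" for i
    using x.mem_blk[of "Suc i" "xs ! i"] y.mem_blk[of "Suc i" "xs ! i"] x.label_in[of "Suc i"] that by simp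
  then show "xs = ys"
    using x.length_xs y.length_xs by (simp add: list_eq_iff_nth_eq)
next
  fix \<pi> assume "\<pi> \<in> word_partition k \<sigma> ` growth_words k 0 n"
  then obtain xs where "xs \<in> growth_words k 0 n" "\<pi> = word_partition k \<sigma> xs" by blast
  then show "\<pi> \<in> sigma_partitions n k \<sigma>"
    using growth_word.sigma_partition growth_word.intro perm by blast
next
  fix \<pi> assume "\<pi> \<in> sigma_partitions n k \<sigma>"
  then obtain B where \<pi>: "\<pi> = map (\<lambda>i. B (\<sigma> i)) [1..<Suc k]"
    and part: "partition_on {1..n} (B ` {1..k})" and mono: "strict_mono_on {1..k} (\<lambda>i. Min (B i))"
    unfolding sigma_partitions_def by blast
  have inj: "l = l'" if "l \<in> {1..k}" "l' \<in> {1..k}" "i \<in> B l" "i \<in> B l'" for i l l'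
  proof -
    have "B l = B l'"
      using that partition_onD2[OF part] unfolding disjoint_def by blast
    then show ?thesis
      using inj_onD[OF strict_mono_on_imp_inj_on[OF mono] _ that(1,2)] by simp
  qed
  have sub: "B l \<subseteq> {1..n}" if "l \<in> {1..k}" for l
    using partition_onD1[OF part] that by blast
  have ne: "B l \<noteq> {}" if "l \<in> {1..k}" for l
    using partition_onD3[OF part] that by force
  define g where "g i = (SOME l. l \<in> {1..k} \<and> i \<in> B l)" for i
  have g: "g i \<in> {1..k} \<and> i \<in> B (g i)" if "i \<in> {1..n}" for i
    unfolding g_def by (rule someI_ex) (use that partition_onD1[OF part] in blast)
  define xs where "xs = map g [1..<Suc n]"
  have len: "length xs = n" by (simp add: xs_def del: upt_Suc)
  have nth: "xs ! i = g (Suc i)" if "i < n" for i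
    using that by (simp add: xs_def del: upt_Suc)
  have pos: "letter_positions xs l = B l" if "l \<in> {1..k}" for l
  proof -
    have "i \<in> letter_positions xs l \<longleftrightarrow> i \<in> {1..n} \<and> g i = l" for i
      by (auto simp: letter_positions_def len nth)
    moreover have "i \<in> {1..n} \<and> g i = l \<longleftrightarrow> i \<in> B l" for i
    proof
      show "i \<in> {1..n} \<and> g i = l \<Longrightarrow> i \<in> B l" using g[of i] by blast
    next
      assume i: "i \<in> B l"
      then have "i \<in> {1..n}" using sub[OF that] by blast
      with i show "i \<in> {1..n} \<and> g i = l" using g[of i] inj[of "g i" l i] that by blast
    qed
    ultimately show ?thesis by blast
  qed
  have "set xs = {1..k}"
  proof (intro equalityI subsetI)
    fix l assume "l \<in> set xs"
    then obtain i where "i < n" "l = g (Suc i)" by (auto simp: in_set_conv_nth len nth)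
    then show "l \<in> {1..k}" using g[of "Suc i"] by simp
  next
    fix l assume l: "l \<in> {1..k}"
    then obtain i where "i \<in> letter_positions xs l" using ne pos by blast
    then show "l \<in> set xs" by (auto simp: letter_positions_def)
  qed
  moreover have "{1..<xs ! i} \<subseteq> set (take i xs)" if "i < n" for i
  proof
    fix l assume l: "l \<in> {1..<xs ! i}"
    have gi: "g (Suc i) \<in> {1..k}" "Suc i \<in> B (g (Suc i))" using g[of "Suc i"] that by auto
    then have lk: "l \<in> {1..k}" "l < g (Suc i)" using l nth[OF that] by auto
    have "Min (B l) < Min (B (g (Suc i)))"
      using strict_mono_onD[OF mono lk(1) gi(1) lk(2)] .
    also have "\<dots> \<le> Suc i"
      using gi(2) finite_subset[OF sub[OF gi(1)]] by simp
    finally have less: "Min (B l) < Suc i" .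
    have "Min (B l) \<in> letter_positions xs l"
      using pos[OF lk(1)] Min_in[OF finite_subset[OF sub[OF lk(1)]] ne[OF lk(1)]] by simp
    then show "l \<in> set (take i xs)"
      using less by (auto simp: letter_positions_def in_set_conv_nth len that intro!: exI[of _ "Min (B l) - 1"])
  qed
  ultimately have "xs \<in> growth_words k 0 n"
    by (simp add: growth_words_def len)
  moreover have "\<pi> = word_partition k \<sigma> xs"
    unfolding \<pi> word_partition_def using pos permutes_in_image[OF perm] by (auto simp del: upt_Suc)
  ultimately show "\<pi> \<in> word_partition k \<sigma> ` growth_words k 0 n" by blast
qed

section \<open>Equidistribution\<close>

text \<open>
  In a monoid semiring, the coefficients of a sum of monomials are the fibre cardinalities of the
  exponent function.
\<close>
lemma equidistributed_onI:
  fixes f g :: "'b \<Rightarrow> 'c::comm_monoid_add"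
  assumes "finite A"
    and "(\<Sum>x\<in>A. Poly_Mapping.single (f x) (1::nat)) = (\<Sum>x\<in>A. Poly_Mapping.single (g x) 1)"
  shows "equidistributed_on A f g"
proof -
  have "Poly_Mapping.lookup (\<Sum>x\<in>A. Poly_Mapping.single (f x) (1::nat)) v = card {x \<in> A. f x = v}" for f :: "'b \<Rightarrow> 'c" and v
  proof -
    have "Poly_Mapping.lookup (\<Sum>x\<in>A. Poly_Mapping.single (f x) (1::nat)) v = (\<Sum>x\<in>A. if f x = v then 1 else 0)"
      by (simp add: lookup_sum lookup_single when_def del: One_nat_def)
    also have "\<dots> = card {x \<in> A. f x = v}"
      using assms(1) by (simp add: sum.inter_filter[symmetric])
    finally show ?thesis .
  qed
  then show ?thesis
    unfolding equidistributed_on_def using assms(2) by metis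
qed

text \<open>
  Here \<open>\<phi>\<close> need not be injective: a fibre of \<open>\<phi> \<circ> f\<close> is a disjoint union of fibres of \<open>f\<close>.
\<close>
lemma equidistributed_on_transfer:
  assumes bij: "bij_betw \<Phi> W P" and fin: "finite W" and eq: "equidistributed_on W f g"
    and F: "\<And>x. x \<in> W \<Longrightarrow> F (\<Phi> x) = \<phi> (f x)" and G: "\<And>x. x \<in> W \<Longrightarrow> G (\<Phi> x) = \<phi> (g x)"
  shows "equidistributed_on P F G"
  unfolding equidistributed_on_def
proof
  fix v
  have fibres: "card {y \<in> P. F y = v} = (\<Sum>w\<in>{w \<in> f ` W \<union> g ` W. \<phi> w = v}. card {x \<in> W. h x = w})"
    if h: "\<And>x. x \<in> W \<Longrightarrow> F (\<Phi> x) = \<phi> (h x)" "h ` W \<subseteq> f ` W \<union> g ` W" for F h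
  proof -
    have "{y \<in> P. F y = v} = \<Phi> ` {x \<in> W. \<phi> (h x) = v}"
      using bij h(1) by (auto simp: bij_betw_def)
    moreover have "inj_on \<Phi> {x \<in> W. \<phi> (h x) = v}"
      using bij by (auto simp: bij_betw_def intro: inj_on_subset)
    ultimately have "card {y \<in> P. F y = v} = card {x \<in> W. \<phi> (h x) = v}"
      by (simp add: card_image)
    also have "{x \<in> W. \<phi> (h x) = v} = (\<Union>w\<in>{w \<in> f ` W \<union> g ` W. \<phi> w = v}. {x \<in> W. h x = w})"
      using subsetD[OF h(2)] by auto
    also have "card \<dots> = (\<Sum>w\<in>{w \<in> f ` W \<union> g ` W. \<phi> w = v}. card {x \<in> W. h x = w})"
      using fin by (intro card_UN_disjoint) auto
    finally show ?thesis .
  qed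
  have "card {y \<in> P. F y = v} = (\<Sum>w\<in>{w \<in> f ` W \<union> g ` W. \<phi> w = v}. card {x \<in> W. f x = w})"
    using fibres[of F f] F by blast
  also have "\<dots> = (\<Sum>w\<in>{w \<in> f ` W \<union> g ` W. \<phi> w = v}. card {x \<in> W. g x = w})"
    using eq by (simp add: equidistributed_on_def)
  also have "\<dots> = card {y \<in> P. G y = v}"
    using fibres[of G g] G by (metis Un_upper2)
  finally show "card {y \<in> P. F y = v} = card {y \<in> P. G y = v}" .
qed

lemma single_power: "Poly_Mapping.single a (1::nat) ^ m = Poly_Mapping.single (\<Sum>i<m. a) 1"
  by (induction m) (simp_all add: mult_single add.commute del: One_nat_def)

lemma sum_const_triple: "(\<Sum>i<m. (a, b, c)) = (m * a, m * b, m * c :: nat)"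
  by (induction m) (simp_all add: zero_prod_def)

theorem theorem3p1:
  fixes n k :: nat and \<sigma> :: "nat \<Rightarrow> nat"
  assumes "1 \<le> k" and "k \<le> n" and "\<sigma> permutes {1..k}"
  shows "equidistributed_on (sigma_partitions n k \<sigma>)
           (\<lambda>\<pi>. (MAK \<pi> + bInv \<pi>, MAK' \<pi> + bInv \<pi>, cinvLSB \<pi>))
           (\<lambda>\<pi>. (MAK' \<pi> + bInv \<pi>, MAK \<pi> + bInv \<pi>, cinvLSB \<pi>)) \<and>
         (\<forall>MAG \<in> {MAK, MAK'}. \<forall>(p::'a::field) q. q \<noteq> 0 \<longrightarrow>
           (\<Sum>\<pi>\<in>sigma_partitions n k \<sigma>. p ^ (MAG \<pi> + bInv \<pi>) * q ^ cinvLSB \<pi>) =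
             q ^ (k * (k - 1)) * (p / q) ^ perm_inv k \<sigma> * pq_Stirling p q n k)"
proof (intro conjI ballI allI impI)
  let ?W = "growth_words k 0 n" and ?\<Phi> = "word_partition k \<sigma>" and ?pos = "inv \<sigma>"
  let ?u = "scan (mak_term ?pos) {}" and ?v = "scan (mak'_term k ?pos) {}" and ?w = "scan (lsb_term ?pos) {}"
  have bij: "bij_betw ?\<Phi> ?W (sigma_partitions n k \<sigma>)"
    by (rule bij_word_partition[OF assms(3)])
  have inj: "inj_on ?pos {1..k}"
    using permutes_inj[OF permutes_inv[OF assms(3)]] by (rule inj_on_subset) simp
  have mak: "MAK (?\<Phi> xs) + bInv (?\<Phi> xs) = perm_inv k \<sigma> + ?u xs"
    and mak': "MAK' (?\<Phi> xs) + bInv (?\<Phi> xs) = perm_inv k \<sigma> + ?v xs"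
    and cinv: "cinvLSB (?\<Phi> xs) + perm_inv k \<sigma> = k * (k - 1) + ?w xs" if "xs \<in> ?W" for xs
  proof -
    interpret growth_word n k \<sigma> xs by unfold_locales (use assms(3) that in auto)
    show "MAK (?\<Phi> xs) + bInv (?\<Phi> xs) = perm_inv k \<sigma> + ?u xs" by (rule MAK_bInv_eq)
    show "MAK' (?\<Phi> xs) + bInv (?\<Phi> xs) = perm_inv k \<sigma> + ?v xs" by (rule MAK'_bInv_eq)
    show "cinvLSB (?\<Phi> xs) + perm_inv k \<sigma> = k * (k - 1) + ?w xs" by (rule cinvLSB_eq)
  qed
  show "equidistributed_on (sigma_partitions n k \<sigma>)
           (\<lambda>\<pi>. (MAK \<pi> + bInv \<pi>, MAK' \<pi> + bInv \<pi>, cinvLSB \<pi>))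
           (\<lambda>\<pi>. (MAK' \<pi> + bInv \<pi>, MAK \<pi> + bInv \<pi>, cinvLSB \<pi>))"
  proof -
    \<comment> \<open>The monomials \<open>p\<^sup>a t\<^sup>b q\<^sup>c\<close>, as elements of a semiring in which they are linearly independent.\<close>
    define X where "X a b c = Poly_Mapping.single (a :: nat, b :: nat, c :: nat) (1 :: nat)" for a b c
    have X_mult: "X a b c * X a' b' c' = X (a + a') (b + b') (c + c')" for a b c a' b' c'
      by (simp add: X_def mult_single)
    have weight: "word_weight k ?pos (X 1 0 0) (X 0 1 0) (X 0 0 1) {} xs = X (?u xs) (?v xs) (?w xs)"
      and weight': "word_weight k ?pos (X 0 1 0) (X 1 0 0) (X 0 0 1) {} xs = X (?v xs) (?u xs) (?w xs)" for xs
      by (simp_all add: word_weight_def X_def single_power sum_const_triple mult_single del: One_nat_def)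
    have sym: "(\<Sum>xs\<in>?W. X (?u xs) (?v xs) (?w xs)) = (\<Sum>xs\<in>?W. X (?v xs) (?u xs) (?w xs))"
      using word_sum_symmetric[OF inj, of n "X 1 0 0" "X 0 1 0" "X 0 0 1"]
      unfolding word_sum_def weight weight' .
    have "equidistributed_on ?W (\<lambda>xs. (?u xs, ?v xs, ?w xs)) (\<lambda>xs. (?v xs, ?u xs, ?w xs))"
      using sym unfolding X_def by (rule equidistributed_onI[OF finite_growth_words])
    then show ?thesis
    proof (rule equidistributed_on_transfer[OF bij finite_growth_words])
      let ?\<phi> = "\<lambda>(a, b, c). (perm_inv k \<sigma> + a, perm_inv k \<sigma> + b, k * (k - 1) + c - perm_inv k \<sigma>)"
      fix xs assume xs: "xs \<in> ?W"
      show "(MAK (?\<Phi> xs) + bInv (?\<Phi> xs), MAK' (?\<Phi> xs) + bInv (?\<Phi> xs), cinvLSB (?\<Phi> xs)) = ?\<phi> (?u xs, ?v xs, ?w xs)"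
        using cinv[OF xs] by (simp add: mak[OF xs] mak'[OF xs])
      show "(MAK' (?\<Phi> xs) + bInv (?\<Phi> xs), MAK (?\<Phi> xs) + bInv (?\<Phi> xs), cinvLSB (?\<Phi> xs)) = ?\<phi> (?v xs, ?u xs, ?w xs)"
        using cinv[OF xs] by (simp add: mak[OF xs] mak'[OF xs])
    qed
  qed
  fix MAG and p q :: 'a
  assume MAG: "MAG \<in> {MAK, MAK'}" and q: "q \<noteq> 0"
  have q_cinv: "q ^ cinvLSB (?\<Phi> xs) = q ^ (k * (k - 1)) * q ^ ?w xs / q ^ perm_inv k \<sigma>" if "xs \<in> ?W" for xs
    using cinv[OF that] q by (metis nonzero_mult_div_cancel_right power_add power_not_zero)
  have factor: "(\<Sum>\<pi>\<in>sigma_partitions n k \<sigma>. p ^ (MAG \<pi> + bInv \<pi>) * q ^ cinvLSB \<pi>) =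
      q ^ (k * (k - 1)) * (p / q) ^ perm_inv k \<sigma> * (\<Sum>xs\<in>?W. p ^ e xs * q ^ ?w xs)"
    if "\<And>xs. xs \<in> ?W \<Longrightarrow> MAG (?\<Phi> xs) + bInv (?\<Phi> xs) = perm_inv k \<sigma> + e xs" for e
  proof -
    have "(\<Sum>\<pi>\<in>sigma_partitions n k \<sigma>. p ^ (MAG \<pi> + bInv \<pi>) * q ^ cinvLSB \<pi>) =
        (\<Sum>xs\<in>?W. p ^ (MAG (?\<Phi> xs) + bInv (?\<Phi> xs)) * q ^ cinvLSB (?\<Phi> xs))"
      by (rule sum.reindex_bij_betw[OF bij, symmetric])
    also have "\<dots> = (\<Sum>xs\<in>?W. q ^ (k * (k - 1)) * (p / q) ^ perm_inv k \<sigma> * (p ^ e xs * q ^ ?w xs))"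
      by (rule sum.cong) (simp_all add: that q_cinv power_add power_divide)
    finally show ?thesis
      by (simp add: sum_distrib_left)
  qed
  have "(\<Sum>xs\<in>?W. p ^ ?u xs * q ^ ?w xs) = pq_Stirling p q n k"
    using word_sum_Stirling[OF inj, of n p q] by (simp add: word_sum_def word_weight_def)
  moreover have "(\<Sum>xs\<in>?W. p ^ ?v xs * q ^ ?w xs) = pq_Stirling p q n k"
    using word_sum_Stirling[OF inj, of n p q] word_sum_symmetric[OF inj, of n p 1 q]
    by (simp add: word_sum_def word_weight_def)
  ultimately show "(\<Sum>\<pi>\<in>sigma_partitions n k \<sigma>. p ^ (MAG \<pi> + bInv \<pi>) * q ^ cinvLSB \<pi>) =
             q ^ (k * (k - 1)) * (p / q) ^ perm_inv k \<sigma> * pq_Stirling p q n k"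
    using MAG factor[of ?u] factor[of ?v] mak mak' by auto
qed

end
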